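(* Let $T$ be an upper probability polynomial functor, $D$ a Lindenbaum $T$-deduction system, $\Delta^*S\in\mathsf{Ing}\,T$ and $x\in X_{\Delta^*S}$. For $\varphi::S$ put $g_x(|\varphi|_S)=\sup\{q\in[0,1]:\mathsf U_{\ge q}\varphi\in x\}$. Then $g_x$ is well defined (if $\varphi,\psi::S$ and $|\varphi|_S=|\psi|_S$ then the two suprema coincide) and is an upper probability measure on the uncertainty space $(X_S,\Sigma_S)$.
   Context: An uncertainty space is $(X,\Sigma)$ with $\Sigma$ an algebra of subsets of $X$ (nonempty, closed under finite unions and complements $U^c=X\setminus U$). A probability measure is a finitely additive $\mu:\Sigma\to[0,1]$ with $\mu(\emptyset)=0,\mu(X)=1$. An upper probability measure is $g:\Sigma\to[0,1]$ with $g(U)=\sup_{\mu\in\mathcal P}\mu(U)$ for a nonempty set $\mathcal P$ of probability measures; equivalently (Anger–Lembcke) $g(\emptyset)=0$, $g(X)=1$ and $k+n\,g(U)\le\sum_{i=1}^mg(U_i)$ for all $m,n,k\ge0$ and $U,U_1,\dots,U_m\in\Sigma$ such that every point of $X$ lies in at least $k$ of the $U_i$ and every point of $U$ in at least $n+k$ of them. $\Delta^*X$: set of upper probability measures with algebra generated by $\beta^{p,q}(U)=\{g:g(U)\ge p,\ 1-g(U^c)\ge q\}$. Products carry the algebra generated by measurable rectangles, coproducts the algebra generated by the $in_j(U_j)$; constant functors send everything to a fixed $(M,\Sigma_M)$. Upper probability polynomial functors: smallest class of endofunctors of uncertainty spaces containing $Id$ and constants, closed under pointwise $\times$, $+$,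 composition with $\Delta^*$. $\mathsf{Ing}\,T$: $\mathsf{Ing}\,Id=\{Id\}$, $\mathsf{Ing}\,M=\{M,Id\}$, $\mathsf{Ing}(T_1\times T_2)=\{T_1\times T_2\}\cup\mathsf{Ing}\,T_1\cup\mathsf{Ing}\,T_2$, same for $+$, $\mathsf{Ing}\,\Delta^*S=\{\Delta^*S\}\cup\mathsf{Ing}\,S$. Formulas of sort $S$ ($\mathsf{Form}_S$): $\bot_S$; $\varphi\to\psi$; $A:M$ for $A\in\Sigma_M$ or $A=\{m\}$; $[\mathsf{pr}_j]\varphi:S_1\times S_2$ ($\varphi:S_j$); $[\mathsf{in}_j]\varphi:S_1+S_2$ ($\varphi:S_j$); $[\mathsf{next}]\varphi:Id$ ($\varphi:T$); $[(p,q)]\varphi:\Delta^*S$ for $p,q\in[0,1]$, $\varphi::S$ ($\varphi::S$: all constant subformulas $A$ lie in $\Sigma_M$). Non-probabilistic labels $\kappa\in\{\mathsf{pr}_j,\mathsf{in}_j,\mathsf{next}\}$ from $S_1\times S_2,S_1+S_2,Id$ to $S_j,S_j,T$; $[\kappa]\Gamma=\{[\kappa]\psi:\psi\in\Gamma\}$. Abbreviations: $\neg,\vee,\wedge,\leftrightarrow,\top_S$; $\mathsf U_{\ge p}\varphi=[(p,0)]\varphi$, $\mathsf L_{\ge p}\varphi=[(0,p)]\varphi$, $\mathsf U_{\le p}\varphi=[(0,1-p)]\neg\varphi$, $\mathsf U_{<p}=\neg\mathsf U_{\ge p}$, $\mathsf L_{<p}=\neg\mathsf L_{\ge p}$. Axioms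 $Ax_S$: Boolean tautologies; for constant $M$: $\{c\}\to A$ if $c\in A$, $\{c\}\to\neg A$ if $c\notin A$; $\neg[\kappa]\varphi\to[\kappa]\neg\varphi$; $\neg[\mathsf{pr}_j]\bot_{S_j}$; $\neg[\mathsf{in}_1]\bot_{S_1}\leftrightarrow[\mathsf{in}_2]\bot_{S_2}$; $\neg[\mathsf{next}]\bot_T$; for $\Delta^*S'$, $\varphi,\psi::S'$: $\mathsf U_{\le p}\varphi\to\mathsf U_{<q}\varphi$ ($p<q$), $\mathsf U_{<p}\varphi\to\mathsf U_{\le p}\varphi$, $\mathsf L_{\ge1}(\varphi\to\psi)\to(\mathsf U_{\ge p}\varphi\to\mathsf U_{\ge p}\psi)$, $[(p,q)]\varphi\leftrightarrow(\mathsf U_{\ge p}\varphi\wedge\mathsf L_{\ge q}\varphi)$. A $T$-deduction system is a family $\vdash_S\subseteq\mathcal P(\mathsf{Form}_S)\times\mathsf{Form}_S$ ($\Gamma\vdash_S\Lambda$: $\Gamma\vdash_S\psi$ for all $\psi\in\Lambda$; $\vdash_S\varphi$: $\emptyset\vdash_S\varphi$) satisfying: Assumption ($\varphi\in\Gamma\cup Ax_S\Rightarrow\Gamma\vdash_S\varphi$); Modus ponens; Cut; Deduction ($\Gamma\cup\{\varphi\}\vdash_S\psi\Rightarrow\Gamma\vdash_S\varphi\to\psi$); Necessitation ($\varphi::S$, $\vdash_S\varphi\Rightarrow\vdash_{\Delta^*S}\mathsf L_{\ge1}\varphi$); Constant ($\{\neg\{c\}:c\in M\}\vdash_M\bot_M$);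 Definite box ($\Gamma\vdash_{S'}\psi\Rightarrow[\kappa]\Gamma\vdash_S[\kappa]\psi$); Archimedean ($\{\mathsf U_{\ge q}\psi:q<p\}\vdash\mathsf U_{\ge p}\psi$, $\{\mathsf L_{\ge q}\psi:q<p\}\vdash\mathsf L_{\ge p}\psi$); Cover rules for $\varphi,\varphi_i::S$, $k\ge0$, $J_m=\{1,\dots,m\}$: (C1) if $n\ge1$, $\vdash_S\varphi\to\bigvee_{I\subseteq J_m,|I|=n+k}\bigwedge_{i\in I}\varphi_i$, $\vdash_S\bigvee_{I\subseteq J_m,|I|=k}\bigwedge_{i\in I}\varphi_i$, $p_i\in[0,1]$, $p=\max(0,\min(1,(\sum p_i-k)/n))$, then $\vdash_{\Delta^*S}(\bigwedge_i\mathsf U_{\le p_i}\varphi_i)\to\mathsf U_{\le p}\varphi$; (C2) if $\vdash_S\bigvee_{I\subseteq J_m,|I|=k}\bigwedge_{i\in I}\varphi_i$ and $\sum p_i<k$, then $\vdash_{\Delta^*S}\neg\bigwedge_i\mathsf U_{\le p_i}\varphi_i$. $\Gamma\subseteq\mathsf{Form}_S$ is $\vdash_S$-consistent if $\Gamma\not\vdash_S\bot_S$, $\vdash_S$-maximal if consistent and negation complete ($\varphi\in\Gamma$ iff $\neg\varphi\notin\Gamma$). $D$ is Lindenbaum if every $\vdash_S$-consistent set is contained in a $\vdash_S$-maximal set. $X_S$ is the set of $\vdash_S$-maximal sets, $|\varphi|_S=\{y\in X_S:\varphi\in y\}$, $\Sigma_S=\{|\varphi|_S:\varphi::S\}$.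 *)

theory Defs
  imports "HOL-Analysis.Analysis"
begin

section \<open>Uncertainty spaces and upper probability measures\<close>

text \<open>An uncertainty space is a pair \<open>(X, \<Sigma>)\<close> with \<open>algebra X \<Sigma>\<close>. Set functions on \<open>\<Sigma>\<close> are total
  HOL functions of which only the values on \<open>\<Sigma>\<close> matter.\<close>

definition fin_prob_measure :: "'a set \<Rightarrow> 'a set set \<Rightarrow> ('a set \<Rightarrow> real) \<Rightarrow> bool" where
  "fin_prob_measure X \<Sigma> \<mu> \<longleftrightarrow>
     (\<forall>U\<in>\<Sigma>. \<mu> U \<in> {0..1}) \<and> additive \<Sigma> \<mu> \<and> \<mu> {} = 0 \<and> \<mu> X = 1"

definition upper_prob_measure :: "'a set \<Rightarrow> 'a set set \<Rightarrow> ('a set \<Rightarrow> real) \<Rightarrow> bool" where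
  "upper_prob_measure X \<Sigma> g \<longleftrightarrow>
     algebra X \<Sigma> \<and> (\<forall>U\<in>\<Sigma>. g U \<in> {0..1}) \<and>
     (\<exists>P. P \<noteq> {} \<and> (\<forall>\<mu>\<in>P. fin_prob_measure X \<Sigma> \<mu>) \<and> (\<forall>U\<in>\<Sigma>. g U = (SUP \<mu>\<in>P. \<mu> U)))"


section \<open>Upper probability polynomial functors and their ingredients\<close>

text \<open>A functor is given by the expression that builds it, since ingredients, sorts and formulas are
  all defined by recursion on that expression. \<open>Delta S\<close> is the composite of \<open>S\<close> with the
  upper probability functor. The constant spaces occurring in an expression are finitely many, so
  they may all be taken with carriers inside one type \<open>'m\<close>.\<close>

datatype 'm fexpr =
    Id
  | Const "'m set" "'m set set"
  | Prod "'m fexpr" "'m fexpr"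
  | Sum "'m fexpr" "'m fexpr"
  | Delta "'m fexpr"

inductive upper_prob_poly :: "'m fexpr \<Rightarrow> bool" where
  "upper_prob_poly Id"
| "algebra M \<Sigma> \<Longrightarrow> upper_prob_poly (Const M \<Sigma>)"
| "\<lbrakk>upper_prob_poly T1; upper_prob_poly T2\<rbrakk> \<Longrightarrow> upper_prob_poly (Prod T1 T2)"
| "\<lbrakk>upper_prob_poly T1; upper_prob_poly T2\<rbrakk> \<Longrightarrow> upper_prob_poly (Sum T1 T2)"
| "upper_prob_poly S \<Longrightarrow> upper_prob_poly (Delta S)"

primrec Ing :: "'m fexpr \<Rightarrow> 'm fexpr set" where
  "Ing Id = {Id}"
| "Ing (Const M \<Sigma>) = {Const M \<Sigma>, Id}"
| "Ing (Prod T1 T2) = {Prod T1 T2} \<union> Ing T1 \<union> Ing T2"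
| "Ing (Sum T1 T2) = {Sum T1 T2} \<union> Ing T1 \<union> Ing T2"
| "Ing (Delta S) = {Delta S} \<union> Ing S"


section \<open>Formulas\<close>

datatype label = Pr1 | Pr2 | In1 | In2 | Next

datatype 'm form =
    Bot "'m fexpr"
  | Imp "'m form" "'m form"
  | Con "'m set" "'m set set" "'m set"  \<comment> \<open>\<open>Con M \<Sigma> A\<close> is the formula \<open>A\<close> of the constant sort \<open>(M, \<Sigma>)\<close>\<close>
  | Box label "'m form"
  | Prob real real "'m form"

text \<open>\<open>lab T \<kappa> S S'\<close>: the non-probabilistic label \<open>\<kappa>\<close> goes from the ingredient \<open>S\<close> of \<open>T\<close> to \<open>S'\<close>.\<close>

inductive lab :: "'m fexpr \<Rightarrow> label \<Rightarrow> 'm fexpr \<Rightarrow> 'm fexpr \<Rightarrow> bool" for T where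
  "Prod S1 S2 \<in> Ing T \<Longrightarrow> lab T Pr1 (Prod S1 S2) S1"
| "Prod S1 S2 \<in> Ing T \<Longrightarrow> lab T Pr2 (Prod S1 S2) S2"
| "Sum S1 S2 \<in> Ing T \<Longrightarrow> lab T In1 (Sum S1 S2) S1"
| "Sum S1 S2 \<in> Ing T \<Longrightarrow> lab T In2 (Sum S1 S2) S2"
| "Id \<in> Ing T \<Longrightarrow> lab T Next Id T"

primrec meas_consts :: "'m form \<Rightarrow> bool" where
  "meas_consts (Bot S) \<longleftrightarrow> True"
| "meas_consts (Imp \<phi> \<psi>) \<longleftrightarrow> meas_consts \<phi> \<and> meas_consts \<psi>"
| "meas_consts (Con M \<Sigma> A) \<longleftrightarrow> A \<in> \<Sigma>"
| "meas_consts (Box \<kappa> \<phi>) \<longleftrightarrow> meas_consts \<phi>"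
| "meas_consts (Prob p q \<phi>) \<longleftrightarrow> meas_consts \<phi>"

text \<open>\<open>has_sort T S \<phi>\<close> is \<open>\<phi> : S\<close>, and \<open>MForm T S\<close> collects the \<open>\<phi>\<close> with \<open>\<phi> :: S\<close>.\<close>

inductive has_sort :: "'m fexpr \<Rightarrow> 'm fexpr \<Rightarrow> 'm form \<Rightarrow> bool" for T where
  "S \<in> Ing T \<Longrightarrow> has_sort T S (Bot S)"
| "\<lbrakk>has_sort T S \<phi>; has_sort T S \<psi>\<rbrakk> \<Longrightarrow> has_sort T S (Imp \<phi> \<psi>)"
| "\<lbrakk>Const M \<Sigma> \<in> Ing T; A \<in> \<Sigma> \<or> (\<exists>m\<in>M. A = {m})\<rbrakk> \<Longrightarrow> has_sort T (Const M \<Sigma>) (Con M \<Sigma> A)"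
| "\<lbrakk>lab T \<kappa> S S'; has_sort T S' \<phi>\<rbrakk> \<Longrightarrow> has_sort T S (Box \<kappa> \<phi>)"
| "\<lbrakk>Delta S \<in> Ing T; p \<in> {0..1}; q \<in> {0..1}; has_sort T S \<phi>; meas_consts \<phi>\<rbrakk>
     \<Longrightarrow> has_sort T (Delta S) (Prob p q \<phi>)"

definition Form :: "'m fexpr \<Rightarrow> 'm fexpr \<Rightarrow> 'm form set" where
  "Form T S = {\<phi>. has_sort T S \<phi>}"

definition MForm :: "'m fexpr \<Rightarrow> 'm fexpr \<Rightarrow> 'm form set" where
  "MForm T S = {\<phi> \<in> Form T S. meas_consts \<phi>}"

text \<open>The first argument of the Boolean connectives is the sort, needed for the falsum.\<close>

definition Neg :: "'m fexpr \<Rightarrow> 'm form \<Rightarrow> 'm form" where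
  "Neg S \<phi> = Imp \<phi> (Bot S)"

definition Top :: "'m fexpr \<Rightarrow> 'm form" where
  "Top S = Neg S (Bot S)"

definition Or :: "'m fexpr \<Rightarrow> 'm form \<Rightarrow> 'm form \<Rightarrow> 'm form" where
  "Or S \<phi> \<psi> = Imp (Neg S \<phi>) \<psi>"

definition And :: "'m fexpr \<Rightarrow> 'm form \<Rightarrow> 'm form \<Rightarrow> 'm form" where
  "And S \<phi> \<psi> = Neg S (Imp \<phi> (Neg S \<psi>))"

definition Iff :: "'m fexpr \<Rightarrow> 'm form \<Rightarrow> 'm form \<Rightarrow> 'm form" where
  "Iff S \<phi> \<psi> = And S (Imp \<phi> \<psi>) (Imp \<psi> \<phi>)"

definition BigOr :: "'m fexpr \<Rightarrow> 'm form list \<Rightarrow> 'm form" where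
  "BigOr S \<phi>s = foldr (Or S) \<phi>s (Bot S)"

definition BigAnd :: "'m fexpr \<Rightarrow> 'm form list \<Rightarrow> 'm form" where
  "BigAnd S \<phi>s = foldr (And S) \<phi>s (Top S)"

text \<open>The disjunction, over all \<open>I \<subseteq> {1..m}\<close> with \<open>r\<close> elements, of the conjunctions of the
  \<open>\<phi> i\<close> with \<open>i \<in> I\<close>; the subsets are enumerated as increasing lists.\<close>

definition at_least :: "'m fexpr \<Rightarrow> nat \<Rightarrow> nat \<Rightarrow> (nat \<Rightarrow> 'm form) \<Rightarrow> 'm form" where
  "at_least S r m \<phi> =
     BigOr S (map (\<lambda>I. BigAnd S (map \<phi> I)) (filter (\<lambda>I. length I = r) (subseqs [1..<Suc m])))"

text \<open>In the modalities \<open>U_le\<close> and \<open>U_lt\<close>, the argument \<open>S\<close> is the sort of \<open>\<phi>\<close>, so that the result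
  has sort \<open>Delta S\<close>.\<close>

definition U_ge :: "real \<Rightarrow> 'm form \<Rightarrow> 'm form" where
  "U_ge p \<phi> = Prob p 0 \<phi>"

definition L_ge :: "real \<Rightarrow> 'm form \<Rightarrow> 'm form" where
  "L_ge p \<phi> = Prob 0 p \<phi>"

definition U_le :: "'m fexpr \<Rightarrow> real \<Rightarrow> 'm form \<Rightarrow> 'm form" where
  "U_le S p \<phi> = Prob 0 (1 - p) (Neg S \<phi>)"

definition U_lt :: "'m fexpr \<Rightarrow> real \<Rightarrow> 'm form \<Rightarrow> 'm form" where
  "U_lt S p \<phi> = Neg (Delta S) (U_ge p \<phi>)"


section \<open>Axioms and deduction systems\<close>

text \<open>Formulas that are neither falsum nor an implication act as propositional atoms.\<close>

fun bool_val :: "('m form \<Rightarrow> bool) \<Rightarrow> 'm form \<Rightarrow> bool" where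
  "bool_val v (Bot S) \<longleftrightarrow> False"
| "bool_val v (Imp \<phi> \<psi>) \<longleftrightarrow> (bool_val v \<phi> \<longrightarrow> bool_val v \<psi>)"
| "bool_val v \<phi> \<longleftrightarrow> v \<phi>"

definition tautology :: "'m form \<Rightarrow> bool" where
  "tautology \<phi> \<longleftrightarrow> (\<forall>v. bool_val v \<phi>)"

inductive is_ax :: "'m fexpr \<Rightarrow> 'm fexpr \<Rightarrow> 'm form \<Rightarrow> bool" for T where
  "\<lbrakk>\<phi> \<in> Form T S; tautology \<phi>\<rbrakk> \<Longrightarrow> is_ax T S \<phi>"
| "\<lbrakk>Const M \<Sigma> \<in> Ing T; Con M \<Sigma> A \<in> Form T (Const M \<Sigma>); c \<in> M; c \<in> A\<rbrakk>
     \<Longrightarrow> is_ax T (Const M \<Sigma>) (Imp (Con M \<Sigma> {c}) (Con M \<Sigma> A))"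
| "\<lbrakk>Const M \<Sigma> \<in> Ing T; Con M \<Sigma> A \<in> Form T (Const M \<Sigma>); c \<in> M; c \<notin> A\<rbrakk>
     \<Longrightarrow> is_ax T (Const M \<Sigma>) (Imp (Con M \<Sigma> {c}) (Neg (Const M \<Sigma>) (Con M \<Sigma> A)))"
| "\<lbrakk>lab T \<kappa> S S'; \<phi> \<in> Form T S'\<rbrakk>
     \<Longrightarrow> is_ax T S (Imp (Neg S (Box \<kappa> \<phi>)) (Box \<kappa> (Neg S' \<phi>)))"
| "Prod S1 S2 \<in> Ing T \<Longrightarrow> is_ax T (Prod S1 S2) (Neg (Prod S1 S2) (Box Pr1 (Bot S1)))"
| "Prod S1 S2 \<in> Ing T \<Longrightarrow> is_ax T (Prod S1 S2) (Neg (Prod S1 S2) (Box Pr2 (Bot S2)))"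
| "Sum S1 S2 \<in> Ing T \<Longrightarrow> is_ax T (Sum S1 S2)
     (Iff (Sum S1 S2) (Neg (Sum S1 S2) (Box In1 (Bot S1))) (Box In2 (Bot S2)))"
| "Id \<in> Ing T \<Longrightarrow> is_ax T Id (Neg Id (Box Next (Bot T)))"
| "\<lbrakk>Delta S \<in> Ing T; \<phi> \<in> MForm T S; p \<in> {0..1}; q \<in> {0..1}; p < q\<rbrakk>
     \<Longrightarrow> is_ax T (Delta S) (Imp (U_le S p \<phi>) (U_lt S q \<phi>))"
| "\<lbrakk>Delta S \<in> Ing T; \<phi> \<in> MForm T S; p \<in> {0..1}\<rbrakk>
     \<Longrightarrow> is_ax T (Delta S) (Imp (U_lt S p \<phi>) (U_le S p \<phi>))"
| "\<lbrakk>Delta S \<in> Ing T; \<phi> \<in> MForm T S; \<psi> \<in> MForm T S; p \<in> {0..1}\<rbrakk>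
     \<Longrightarrow> is_ax T (Delta S) (Imp (L_ge 1 (Imp \<phi> \<psi>)) (Imp (U_ge p \<phi>) (U_ge p \<psi>)))"
| "\<lbrakk>Delta S \<in> Ing T; \<phi> \<in> MForm T S; p \<in> {0..1}; q \<in> {0..1}\<rbrakk>
     \<Longrightarrow> is_ax T (Delta S) (Iff (Delta S) (Prob p q \<phi>) (And (Delta S) (U_ge p \<phi>) (L_ge q \<phi>)))"

definition Ax :: "'m fexpr \<Rightarrow> 'm fexpr \<Rightarrow> 'm form set" where
  "Ax T S = {\<phi>. is_ax T S \<phi>}"

text \<open>\<open>D S \<Gamma> \<phi>\<close> stands for \<open>\<Gamma> \<turnstile>\<^sub>S \<phi>\<close>. The family is indexed by the ingredients of \<open>T\<close>; the values of
  \<open>D\<close> at other sorts are irrelevant.\<close>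

locale deduction_system =
  fixes T :: "'m fexpr" and D :: "'m fexpr \<Rightarrow> 'm form set \<Rightarrow> 'm form \<Rightarrow> bool"
  assumes well_sorted:
    "\<lbrakk>S \<in> Ing T; D S \<Gamma> \<phi>\<rbrakk> \<Longrightarrow> \<Gamma> \<subseteq> Form T S \<and> \<phi> \<in> Form T S"
  and assumption_rule:
    "\<lbrakk>S \<in> Ing T; \<Gamma> \<subseteq> Form T S; \<phi> \<in> \<Gamma> \<union> Ax T S\<rbrakk> \<Longrightarrow> D S \<Gamma> \<phi>"
  and modus_ponens:
    "\<lbrakk>S \<in> Ing T; \<phi> \<in> Form T S; \<psi> \<in> Form T S\<rbrakk> \<Longrightarrow> D S {\<phi>, Imp \<phi> \<psi>} \<psi>"
  and cut:
    "\<lbrakk>S \<in> Ing T; \<Gamma> \<subseteq> Form T S; \<forall>\<psi>\<in>\<Lambda>. D S \<Gamma> \<psi>; D S \<Lambda> \<phi>\<rbrakk> \<Longrightarrow> D S \<Gamma> \<phi>"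
  and deduction:
    "\<lbrakk>S \<in> Ing T; D S (\<Gamma> \<union> {\<phi>}) \<psi>\<rbrakk> \<Longrightarrow> D S \<Gamma> (Imp \<phi> \<psi>)"
  and necessitation:
    "\<lbrakk>Delta S \<in> Ing T; \<phi> \<in> MForm T S; D S {} \<phi>\<rbrakk> \<Longrightarrow> D (Delta S) {} (L_ge 1 \<phi>)"
  and constant_rule:
    "Const M \<Sigma> \<in> Ing T
       \<Longrightarrow> D (Const M \<Sigma>) {Neg (Const M \<Sigma>) (Con M \<Sigma> {c}) | c. c \<in> M} (Bot (Const M \<Sigma>))"
  and definite_box:
    "\<lbrakk>lab T \<kappa> S S'; D S' \<Gamma> \<psi>\<rbrakk> \<Longrightarrow> D S (Box \<kappa> ` \<Gamma>) (Box \<kappa> \<psi>)"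
  and archimedean_U:
    "\<lbrakk>Delta S \<in> Ing T; \<psi> \<in> MForm T S; p \<in> {0..1}\<rbrakk>
       \<Longrightarrow> D (Delta S) {U_ge q \<psi> | q. q \<in> {0..1} \<and> q < p} (U_ge p \<psi>)"
  and archimedean_L:
    "\<lbrakk>Delta S \<in> Ing T; \<psi> \<in> MForm T S; p \<in> {0..1}\<rbrakk>
       \<Longrightarrow> D (Delta S) {L_ge q \<psi> | q. q \<in> {0..1} \<and> q < p} (L_ge p \<psi>)"
  and cover1:
    "\<And>S \<phi> (\<psi> :: nat \<Rightarrow> 'm form) (p :: nat \<Rightarrow> real) (m :: nat) (n :: nat) (k :: nat).
       \<lbrakk>Delta S \<in> Ing T; n \<ge> 1; \<phi> \<in> MForm T S;
        \<forall>i\<in>{1..m}. \<psi> i \<in> MForm T S \<and> p i \<in> {0..1};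
        D S {} (Imp \<phi> (at_least S (n + k) m \<psi>));
        D S {} (at_least S k m \<psi>)\<rbrakk>
       \<Longrightarrow> D (Delta S) {}
             (Imp (BigAnd (Delta S) (map (\<lambda>i. U_le S (p i) (\<psi> i)) [1..<Suc m]))
                  (U_le S (max 0 (min 1 (((\<Sum>i=1..m. p i) - real k) / real n))) \<phi>))"
  and cover2:
    "\<And>S (\<psi> :: nat \<Rightarrow> 'm form) (p :: nat \<Rightarrow> real) (m :: nat) (k :: nat).
       \<lbrakk>Delta S \<in> Ing T;
        \<forall>i\<in>{1..m}. \<psi> i \<in> MForm T S \<and> p i \<in> {0..1};
        D S {} (at_least S k m \<psi>);
        (\<Sum>i=1..m. p i) < real k\<rbrakk>
       \<Longrightarrow> D (Delta S) {}
             (Neg (Delta S) (BigAnd (Delta S) (map (\<lambda>i. U_le S (p i) (\<psi> i)) [1..<Suc m])))"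


section \<open>Maximal sets and the canonical spaces\<close>

definition consistent ::
  "'m fexpr \<Rightarrow> ('m fexpr \<Rightarrow> 'm form set \<Rightarrow> 'm form \<Rightarrow> bool) \<Rightarrow> 'm fexpr \<Rightarrow> 'm form set \<Rightarrow> bool" where
  "consistent T D S \<Gamma> \<longleftrightarrow> \<Gamma> \<subseteq> Form T S \<and> \<not> D S \<Gamma> (Bot S)"

definition maximal ::
  "'m fexpr \<Rightarrow> ('m fexpr \<Rightarrow> 'm form set \<Rightarrow> 'm form \<Rightarrow> bool) \<Rightarrow> 'm fexpr \<Rightarrow> 'm form set \<Rightarrow> bool" where
  "maximal T D S \<Gamma> \<longleftrightarrow>
     consistent T D S \<Gamma> \<and> (\<forall>\<phi>\<in>Form T S. \<phi> \<in> \<Gamma> \<longleftrightarrow> Neg S \<phi> \<notin> \<Gamma>)"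

definition lindenbaum ::
  "'m fexpr \<Rightarrow> ('m fexpr \<Rightarrow> 'm form set \<Rightarrow> 'm form \<Rightarrow> bool) \<Rightarrow> bool" where
  "lindenbaum T D \<longleftrightarrow>
     (\<forall>S\<in>Ing T. \<forall>\<Gamma>. consistent T D S \<Gamma> \<longrightarrow> (\<exists>\<Gamma>'. maximal T D S \<Gamma>' \<and> \<Gamma> \<subseteq> \<Gamma>'))"

definition canon_space ::
  "'m fexpr \<Rightarrow> ('m fexpr \<Rightarrow> 'm form set \<Rightarrow> 'm form \<Rightarrow> bool) \<Rightarrow> 'm fexpr \<Rightarrow> 'm form set set" where
  "canon_space T D S = {y. maximal T D S y}"

definition truth_set ::
  "'m fexpr \<Rightarrow> ('m fexpr \<Rightarrow> 'm form set \<Rightarrow> 'm form \<Rightarrow> bool) \<Rightarrow> 'm fexpr \<Rightarrow> 'm form \<Rightarrow> 'm form set set"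
  where
  "truth_set T D S \<phi> = {y \<in> canon_space T D S. \<phi> \<in> y}"

definition canon_algebra ::
  "'m fexpr \<Rightarrow> ('m fexpr \<Rightarrow> 'm form set \<Rightarrow> 'm form \<Rightarrow> bool) \<Rightarrow> 'm fexpr \<Rightarrow> 'm form set set set" where
  "canon_algebra T D S = truth_set T D S ` MForm T S"

definition sup_U_ge :: "'m form set \<Rightarrow> 'm form \<Rightarrow> real" where
  "sup_U_ge x \<phi> = Sup {q \<in> {0..1}. U_ge q \<phi> \<in> x}"

text \<open>The description below denotes a value at \<open>U\<close> in the canonical algebra exactly when all
  representatives \<open>\<phi>\<close> of \<open>U\<close> give the same supremum.\<close>

definition canon_upper ::
  "'m fexpr \<Rightarrow> ('m fexpr \<Rightarrow> 'm form set \<Rightarrow> 'm form \<Rightarrow> bool) \<Rightarrow> 'm fexpr \<Rightarrow> 'm form set \<Rightarrow>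
   'm form set set \<Rightarrow> real" where
  "canon_upper T D S x U =
     (THE r. (\<exists>\<phi>\<in>MForm T S. truth_set T D S \<phi> = U) \<and>
             (\<forall>\<phi>\<in>MForm T S. truth_set T D S \<phi> = U \<longrightarrow> sup_U_ge x \<phi> = r))"

end

theory Submission
  imports Defs "HOL-Library.Function_Algebras" "HOL-Library.Sublist"
begin

text \<open>By the Lindenbaum property, a formula that belongs to every maximal set is provable. Hence
  \<open>|\<phi>| \<subseteq> |\<psi>|\<close> makes \<open>\<phi> \<rightarrow> \<psi>\<close> provable, which gives well-definedness of \<open>g\<close>, and any semantic
  covering of truth sets is a provable covering, so that the two cover rules, applied with
  \<open>p\<^sub>i = g |\<phi>\<^sub>i|\<close>, yield \<open>k + n g(U) \<le> \<Sum> g(U\<^sub>i)\<close>. This is legitimate because the Archimedean rules make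
  \<open>U\<^bsub>\<le>p\<^esub> \<phi> \<in> x\<close> equivalent to \<open>g |\<phi>| \<le> p\<close>.

  The covering inequality implies that \<open>g\<close> is an upper envelope by a Hahn--Banach argument:
  \<open>p f = inf (\<Sum> g(U\<^sub>i) - k) / n\<close>, over all coverings \<open>n f + k \<le> \<Sum> 1\<^bsub>U\<^sub>i\<^esub>\<close>, is a sublinear functional on the
  bounded integer-valued functions with \<open>p 1\<^sub>U = g(U)\<close>, so it dominates an additive functional that
  agrees with it at \<open>1\<^sub>U\<close>.\<close>


section \<open>A Hahn--Banach theorem for abelian groups\<close>

text \<open>Ring structure on the ambient type only serves to write integer multiples as products.\<close>

locale additive_subgroup =
  fixes B :: "'b::ring_1 set"
  assumes zero_closed: "0 \<in> B"
    and add_closed: "x \<in> B \<Longrightarrow> y \<in> B \<Longrightarrow> x + y \<in> B"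
    and uminus_closed: "x \<in> B \<Longrightarrow> - x \<in> B"
begin

lemma of_nat_mult_closed: "x \<in> B \<Longrightarrow> of_nat n * x \<in> B"
  by (induction n) (auto simp: zero_closed add_closed algebra_simps)

text \<open>Natural multiples take the place of scaling by nonnegative reals. The reverse inequality
  of homogeneity follows from subadditivity.\<close>

definition sublinear :: "('b \<Rightarrow> real) \<Rightarrow> bool" where
  "sublinear q \<longleftrightarrow> q 0 = 0 \<and> (\<forall>x\<in>B. \<forall>y\<in>B. q (x + y) \<le> q x + q y) \<and>
     (\<forall>x\<in>B. \<forall>n. real n * q x \<le> q (of_nat n * x))"

lemma sublinear_zero: "sublinear q \<Longrightarrow> q 0 = 0"
  and sublinear_add: "sublinear q \<Longrightarrow> x \<in> B \<Longrightarrow> y \<in> B \<Longrightarrow> q (x + y) \<le> q x + q y"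
  by (auto simp: sublinear_def)

lemma sublinear_mult:
  assumes q: "sublinear q" and x: "x \<in> B"
  shows "q (of_nat n * x) = real n * q x"
proof (rule antisym)
  show "q (of_nat n * x) \<le> real n * q x"
  proof (induction n)
    case (Suc n)
    have "q (x + of_nat n * x) \<le> q x + q (of_nat n * x)"
      by (intro sublinear_add q x of_nat_mult_closed)
    with Suc show ?case by (simp add: algebra_simps)
  qed (simp add: sublinear_zero[OF q])
  show "real n * q x \<le> q (of_nat n * x)"
    using q x by (auto simp: sublinear_def)
qed

lemma sublinear_ge:
  assumes "sublinear q" "x \<in> B"
  shows "- q (- x) \<le> q x"
  using sublinear_add[of q x "- x"] sublinear_zero[of q] assms uminus_closed by auto

text \<open>The largest sublinear functional \<open>q' \<le> q\<close> with \<open>q' (- f) \<le> - q f\<close>.\<close>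

definition tilt :: "('b \<Rightarrow> real) \<Rightarrow> 'b \<Rightarrow> 'b \<Rightarrow> real" where
  "tilt q f h = (INF n. q (h + of_nat n * f) - real n * q f)"

section \<open>Tilting a sublinear functional towards a fixed element\<close>

context
  fixes q f assumes q: "sublinear q" and f: "f \<in> B"
begin

text \<open>The infimum is finite: \<open>real n * q f = q (of_nat n * f) \<le> q (- h) + q (h +
  of_nat n * f)\<close>, so \<open>- q (- h)\<close> bounds all its terms from below.\<close>

lemma tilt_le:
  assumes h: "h \<in> B"
  shows "tilt q f h \<le> q (h + of_nat n * f) - real n * q f"
  unfolding tilt_def
proof (rule cINF_lower)
  show "bdd_below (range (\<lambda>n. q (h + of_nat n * f) - real n * q f))"
  proof (rule bdd_belowI2)
    fix n :: nat
    have "q (- h + (h + of_nat n * f)) \<le> q (- h) + q (h + of_nat n * f)"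
      by (intro sublinear_add q uminus_closed add_closed h of_nat_mult_closed f)
    then show "- q (- h) \<le> q (h + of_nat n * f) - real n * q f"
      using sublinear_mult[OF q f] by simp
  qed
qed simp

lemma le_tiltI: "(\<And>n. c \<le> q (h + of_nat n * f) - real n * q f) \<Longrightarrow> c \<le> tilt q f h"
  unfolding tilt_def by (rule cINF_greatest) auto

lemma tilt_le_self: "h \<in> B \<Longrightarrow> tilt q f h \<le> q h"
  using tilt_le[of h 0] by simp

lemma tilt_uminus: "tilt q f (- f) \<le> - q f"
  using tilt_le[of "- f" 1] uminus_closed f sublinear_zero[OF q] by simp

lemma sublinear_tilt: "sublinear (tilt q f)"
  unfolding sublinear_def
proof (intro conjI ballI allI)
  show "tilt q f 0 = 0"
    using sublinear_mult[OF q f] by (simp add: tilt_def)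
next
  fix x y assume x: "x \<in> B" and y: "y \<in> B"
  \<comment> \<open>The term with index \<open>n\<close> for \<open>x\<close> and the one with index
    \<open>m\<close> for \<open>y\<close> together dominate the term with index \<open>n + m\<close>
    for \<open>x + y\<close>.\<close>
  have *: "tilt q f (x + y)
      \<le> (q (x + of_nat n * f) - real n * q f) + (q (y + of_nat m * f) - real m * q f)" for n m
  proof -
    have "tilt q f (x + y) \<le> q (x + y + of_nat (n + m) * f) - real (n + m) * q f"
      by (intro tilt_le add_closed x y)
    moreover have "q ((x + of_nat n * f) + (y + of_nat m * f))
        \<le> q (x + of_nat n * f) + q (y + of_nat m * f)"
      by (intro sublinear_add q add_closed x y of_nat_mult_closed f)
    ultimately show ?thesis by (simp add: algebra_simps)
  qed
  have "tilt q f (x + y) - tilt q f x \<le> q (y + of_nat m * f) - real m * q f" for m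
  proof -
    have "tilt q f (x + y) - (q (y + of_nat m * f) - real m * q f) \<le> tilt q f x"
    proof (rule le_tiltI)
      fix n show "tilt q f (x + y) - (q (y + of_nat m * f) - real m * q f)
          \<le> q (x + of_nat n * f) - real n * q f"
        using *[of n m] by linarith
    qed
    then show ?thesis by linarith
  qed
  then have "tilt q f (x + y) - tilt q f x \<le> tilt q f y" by (rule le_tiltI)
  then show "tilt q f (x + y) \<le> tilt q f x + tilt q f y" by linarith
next
  fix x k assume x: "x \<in> B"
  show "real k * tilt q f x \<le> tilt q f (of_nat k * x)"
  proof (cases "k = 0")
    case True
    then show ?thesis using sublinear_mult[OF q f] by (simp add: tilt_def)
  next
    case False
    show ?thesis
    proof (rule le_tiltI)
      fix n
      \<comment> \<open>Scaling by \<open>k\<close> turns the shift by \<open>n\<close> copies of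
        \<open>f\<close> into one by \<open>k * n\<close> copies. The surplus \<open>m\<close>, a
        true difference since \<open>k > 0\<close>, is split off by subadditivity and costs exactly
        \<open>real m * q f\<close>.\<close>
      define m where "m = k * n - n"
      have m: "k * n = n + m" using False by (cases k) (auto simp: m_def)
      have "real k * tilt q f x \<le> real k * (q (x + of_nat n * f) - real n * q f)"
        by (intro mult_left_mono tilt_le x) simp
      also have "\<dots> = q (of_nat k * (x + of_nat n * f)) - real (k * n) * q f"
        by (subst sublinear_mult[OF q]) (auto simp: add_closed x of_nat_mult_closed f algebra_simps)
      also have "of_nat k * (x + of_nat n * f) = of_nat k * x + of_nat (k * n) * f"
        by (simp add: algebra_simps)
      also have "\<dots> = (of_nat k * x + of_nat n * f) + of_nat m * f"
        unfolding m by (simp add: algebra_simps)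
      also have "q ((of_nat k * x + of_nat n * f) + of_nat m * f) - real (k * n) * q f
          \<le> q (of_nat k * x + of_nat n * f) + q (of_nat m * f) - real (k * n) * q f"
        using sublinear_add[OF q, of "of_nat k * x + of_nat n * f" "of_nat m * f"]
        by (simp add: add_closed x of_nat_mult_closed f)
      also have "\<dots> = q (of_nat k * x + of_nat n * f) - real n * q f"
        unfolding m sublinear_mult[OF q f] by (simp add: algebra_simps)
      finally show "real k * tilt q f x \<le> q (of_nat k * x + of_nat n * f) - real n * q f" .
    qed
  qed
qed

end

text \<open>Normalising functionals to vanish outside \<open>B\<close> makes the pointwise order antisymmetric.\<close>

lemma minimal_sublinear_exists:
  assumes p: "sublinear p"
  obtains q where "sublinear q" "\<And>x. x \<in> B \<Longrightarrow> q x \<le> p x"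
    "\<And>r. sublinear r \<Longrightarrow> (\<And>x. x \<in> B \<Longrightarrow> r x \<le> q x) \<Longrightarrow> (\<And>x. x \<in> B \<Longrightarrow> r x = q x)"
proof -
  define A where "A = {q. sublinear q \<and> (\<forall>x\<in>B. q x \<le> p x) \<and> (\<forall>x. x \<notin> B \<longrightarrow> q x = 0)}"
  define cut where "cut r = (\<lambda>x. if x \<in> B then r x else 0)" for r :: "'b \<Rightarrow> real"
  have cut: "cut r \<in> A" if "sublinear r" "\<And>x. x \<in> B \<Longrightarrow> r x \<le> p x" for r
    using that by (auto simp: A_def cut_def sublinear_def zero_closed add_closed of_nat_mult_closed)
  \<comment> \<open>The order is reversed, so that the maximal element from Zorn's lemma is a
    minimal functional and chains need lower bounds.\<close>
  let ?P = "\<lambda>q r :: 'b \<Rightarrow> real. r \<le> q"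
  have "\<exists>m\<in>A. \<forall>a\<in>A. ?P m a \<longrightarrow> a = m"
  proof (rule predicate_Zorn)
    show "partial_order_on A (relation_of ?P A)"
      by (rule partial_order_on_relation_ofI) auto
  next
    fix C assume "C \<in> Chains (relation_of ?P A)"
    then have CA: "C \<subseteq> A" and comp: "\<And>q r. q \<in> C \<Longrightarrow> r \<in> C \<Longrightarrow> q \<le> r \<or> r \<le> q"
      by (auto simp: Chains_def relation_of_def)
    show "\<exists>u\<in>A. \<forall>a\<in>C. u \<le> a"
    proof (cases "C = {}")
      case True
      then show ?thesis using cut[OF p] by auto
    next
      case False
      define u where "u x = (INF q\<in>C. q x)" for x
      \<comment> \<open>The lower bound is uniform over the chain:
        \<open>- p (- x) \<le> - q (- x) \<le> q x\<close>.\<close>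
      have bdd: "bdd_below ((\<lambda>q. q x) ` C)" if "x \<in> B" for x
      proof (rule bdd_belowI2)
        fix q assume "q \<in> C"
        then have "sublinear q" "q (- x) \<le> p (- x)"
          using CA that uminus_closed by (auto simp: A_def)
        then show "- p (- x) \<le> q x" using sublinear_ge[of q x] that by linarith
      qed
      have u_le: "u x \<le> q x" if "x \<in> B" "q \<in> C" for x q
        unfolding u_def by (rule cINF_lower[OF bdd]) (use that in auto)
      have le_u: "c \<le> u x" if "\<And>q. q \<in> C \<Longrightarrow> c \<le> q x" for c x
        unfolding u_def by (rule cINF_greatest[OF False that])
      have sub: "sublinear q" and le_p: "x \<in> B \<Longrightarrow> q x \<le> p x" if "q \<in> C" for q x
        using CA that by (auto simp: A_def)
      have "sublinear u"
        unfolding sublinear_def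
      proof (intro conjI ballI allI)
        have "u 0 = (INF q\<in>C. 0)"
          unfolding u_def by (rule INF_cong) (auto simp: sublinear_zero sub)
        then show "u 0 = 0" using False by simp
      next
        fix x y assume x: "x \<in> B" and y: "y \<in> B"
        \<comment> \<open>Subadditivity of an infimum needs the chain: the smaller of
          \<open>q\<close> and \<open>r\<close> serves both summands at once.\<close>
        have *: "u (x + y) \<le> q x + r y" if q: "q \<in> C" and r: "r \<in> C" for q r
        proof -
          obtain s where s: "s \<in> C" "s \<le> q" "s \<le> r" using comp[OF q r] q r by auto
          have "u (x + y) \<le> s (x + y)" by (intro u_le add_closed x y s)
          also have "\<dots> \<le> s x + s y" by (intro sublinear_add sub s x y)
          also have "\<dots> \<le> q x + r y" using s by (intro add_mono) (auto simp: le_fun_def)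
          finally show ?thesis .
        qed
        have "u (x + y) - u x \<le> r y" if r: "r \<in> C" for r
        proof -
          have "u (x + y) - r y \<le> u x"
          proof (rule le_u)
            fix q assume "q \<in> C"
            then show "u (x + y) - r y \<le> q x" using *[OF _ r] by force
          qed
          then show ?thesis by linarith
        qed
        then have "u (x + y) - u x \<le> u y" by (rule le_u)
        then show "u (x + y) \<le> u x + u y" by linarith
      next
        fix x n assume x: "x \<in> B"
        show "real n * u x \<le> u (of_nat n * x)"
        proof (rule le_u)
          fix q assume "q \<in> C"
          then show "real n * u x \<le> q (of_nat n * x)"
            using u_le[OF x] sublinear_mult[OF sub x, of q n] by (simp add: mult_left_mono)
        qed
      qed
      moreover have "u x \<le> p x" if "x \<in> B" for x
        using False u_le[OF that] le_p[OF _ that] by force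
      ultimately have "cut u \<in> A" by (rule cut)
      moreover have "cut u \<le> q" if "q \<in> C" for q
        using u_le[OF _ that] CA that by (auto simp: le_fun_def cut_def A_def)
      ultimately show ?thesis by blast
    qed
  qed
  then obtain q where q: "q \<in> A" and min: "\<And>r. r \<in> A \<Longrightarrow> r \<le> q \<Longrightarrow> r = q" by auto
  show thesis
  proof
    show "sublinear q" "\<And>x. x \<in> B \<Longrightarrow> q x \<le> p x" using q by (auto simp: A_def)
    fix r x assume r: "sublinear r" "\<And>x. x \<in> B \<Longrightarrow> r x \<le> q x" and x: "x \<in> B"
    have "cut r \<in> A" using r q by (intro cut) (force simp: A_def)+
    moreover have "cut r \<le> q" using r q by (auto simp: le_fun_def cut_def A_def)
    ultimately have "cut r = q" by (rule min)
    then show "r x = q x" using x by (auto simp: cut_def)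
  qed
qed

text \<open>Take \<open>\<mu>\<close> minimal below \<open>tilt p f\<close>. Each tilt of
  \<open>\<mu>\<close> lies below \<open>\<mu>\<close>, hence equals it, and its value at the
  negative of the tilting element forces \<open>\<mu> (- x) = - \<mu> x\<close>. An odd subadditive
  function is additive. Having tilted \<open>p\<close> at \<open>f\<close> beforehand gives
  \<open>\<mu> (- f) \<le> - p f\<close>, so \<open>\<mu> f\<close> cannot fall below
  \<open>p f\<close>.\<close>

theorem hahn_banach:
  assumes p: "sublinear p" and f: "f \<in> B"
  obtains \<mu> where "\<And>x y. x \<in> B \<Longrightarrow> y \<in> B \<Longrightarrow> \<mu> (x + y) = \<mu> x + \<mu> y"
    "\<And>x. x \<in> B \<Longrightarrow> \<mu> x \<le> p x" "\<mu> f = (p f :: real)"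
proof -
  obtain \<mu> where \<mu>: "sublinear \<mu>" and le: "\<And>x. x \<in> B \<Longrightarrow> \<mu> x \<le> tilt p f x"
    and min: "\<And>r x. sublinear r \<Longrightarrow> (\<And>x. x \<in> B \<Longrightarrow> r x \<le> \<mu> x) \<Longrightarrow> x \<in> B \<Longrightarrow> r x = \<mu> x"
    using minimal_sublinear_exists[OF sublinear_tilt[OF p f]] by blast
  have minus: "\<mu> (- x) = - \<mu> x" if x: "x \<in> B" for x
  proof -
    have "tilt \<mu> x (- x) = \<mu> (- x)"
      by (rule min) (auto intro: sublinear_tilt tilt_le_self \<mu> x uminus_closed)
    then have "\<mu> (- x) \<le> - \<mu> x" using tilt_uminus[OF \<mu> x] by simp
    then show ?thesis using sublinear_ge[OF \<mu> x] by linarith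
  qed
  show thesis
  proof
    fix x y assume x: "x \<in> B" and y: "y \<in> B"
    have "\<mu> (- x + - y) \<le> \<mu> (- x) + \<mu> (- y)"
      by (intro sublinear_add \<mu> uminus_closed x y)
    moreover have "\<mu> (- x + - y) = - \<mu> (x + y)"
      using minus[OF add_closed[OF x y]] by (simp add: add.commute)
    ultimately have "- \<mu> (x + y) \<le> - \<mu> x - \<mu> y"
      using minus x y by simp
    then show "\<mu> (x + y) = \<mu> x + \<mu> y" using sublinear_add[OF \<mu> x y] by linarith
  next
    show le_p: "\<mu> x \<le> p x" if "x \<in> B" for x
      using le tilt_le_self[OF p f] that by force
    show "\<mu> f = p f"
      using le[of "- f"] tilt_uminus[OF p f] minus[OF f] le_p[OF f] uminus_closed[OF f] by linarith
  qed
qed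

end


section \<open>Upper probabilities from the covering condition\<close>

definition multiplicity_in :: "'a set list \<Rightarrow> 'a \<Rightarrow> nat" where
  "multiplicity_in Us x = length (filter (\<lambda>U. x \<in> U) Us)"

lemma multiplicity_in_append [simp]:
  "multiplicity_in (Us @ Vs) x = multiplicity_in Us x + multiplicity_in Vs x"
  by (simp add: multiplicity_in_def)

lemma multiplicity_in_Nil [simp]: "multiplicity_in [] x = 0"
  by (simp add: multiplicity_in_def)

lemma multiplicity_in_concat_replicate [simp]:
  "multiplicity_in (concat (replicate n Us)) x = n * multiplicity_in Us x"
  by (induction n) auto

lemma sum_list_concat_replicate:
  fixes g :: "'a \<Rightarrow> real"
  shows "sum_list (map g (concat (replicate n xs))) = real n * sum_list (map g xs)"
  by (induction n) (auto simp: algebra_simps)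

text \<open>The Anger--Lembcke condition. Its instance with \<open>Us = []\<close>,
  \<open>U = {}\<close>, \<open>k = 0\<close>, \<open>n = 1\<close> yields \<open>g {} = 0\<close>,
  and the one with \<open>Us = [\<Omega>]\<close>, \<open>k = 1\<close>, \<open>n = 0\<close> yields
  \<open>g \<Omega> = 1\<close>.\<close>

locale cover_function = algebra \<Omega> M for \<Omega> :: "'a set" and M +
  fixes g :: "'a set \<Rightarrow> real"
  assumes range: "U \<in> M \<Longrightarrow> g U \<in> {0..1}"
    and cover: "\<lbrakk>U \<in> M; set Us \<subseteq> M; \<And>x. x \<in> \<Omega> \<Longrightarrow> k \<le> multiplicity_in Us x;
      \<And>x. x \<in> U \<Longrightarrow> n + k \<le> multiplicity_in Us x\<rbrakk> \<Longrightarrow> real k + real n * g U \<le> sum_list (map g Us)"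
begin

section \<open>The upper integral of bounded integer-valued functions\<close>

definition bounded_functions :: "('a \<Rightarrow> int) set" where
  "bounded_functions = {f. \<exists>N. \<forall>x\<in>\<Omega>. \<bar>f x\<bar> \<le> int N}"

text \<open>This is the pointwise bound of \<open>f\<close> by (sum of the indicators of
  \<open>Us\<close>, minus \<open>k\<close>) divided by \<open>n\<close>, cleared of denominators;
  \<open>cover_value\<close> is the price that \<open>g\<close> assigns to the bounding
  function.\<close>

definition covers :: "('a \<Rightarrow> int) \<Rightarrow> nat \<Rightarrow> nat \<Rightarrow> 'a set list \<Rightarrow> bool" where
  "covers f n k Us \<longleftrightarrow> n \<ge> 1 \<and> set Us \<subseteq> M \<and>
     (\<forall>x\<in>\<Omega>. int n * f x + int k \<le> int (multiplicity_in Us x))"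

definition cover_value :: "nat \<Rightarrow> nat \<Rightarrow> 'a set list \<Rightarrow> real" where
  "cover_value n k Us = (sum_list (map g Us) - real k) / real n"

definition upper_integral :: "('a \<Rightarrow> int) \<Rightarrow> real" where
  "upper_integral f = Inf {cover_value n k Us | n k Us. covers f n k Us}"

lemma sum_list_nonneg_g: "set Us \<subseteq> M \<Longrightarrow> 0 \<le> sum_list (map g Us)"
  using range by (intro sum_list_nonneg) force

text \<open>If \<open>f\<close> is at least \<open>- N\<close>, then \<open>Us\<close> covers every
  point of \<open>\<Omega>\<close> at least \<open>k - n * N\<close> times, which bounds the sum of
  \<open>g\<close> over \<open>Us\<close> from below. This keeps the infimum in
  \<open>upper_integral\<close> finite.\<close>

lemma cover_value_ge:
  assumes c: "covers f n k Us" and N: "\<And>x. x \<in> \<Omega> \<Longrightarrow> - int N \<le> f x"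
  shows "- real N \<le> cover_value n k Us"
proof -
  have n: "n \<ge> 1" and Us: "set Us \<subseteq> M" using c by (auto simp: covers_def)
  have "real k - real (n * N) \<le> sum_list (map g Us)"
  proof (cases "n * N \<le> k")
    case True
    have "k - n * N \<le> multiplicity_in Us x" if "x \<in> \<Omega>" for x
    proof -
      have "int n * - int N \<le> int n * f x" by (intro mult_left_mono N that) simp
      moreover have "int n * f x + int k \<le> int (multiplicity_in Us x)"
        using c that by (auto simp: covers_def)
      ultimately have "int k - int (n * N) \<le> int (multiplicity_in Us x)" by simp
      then show ?thesis by linarith
    qed
    \<comment> \<open>With \<open>n = 0\<close> and \<open>U = {}\<close> only the uniform covering
      of \<open>\<Omega>\<close> is left in the condition.\<close>
    then have "real (k - n * N) + real 0 * g {} \<le> sum_list (map g Us)"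
      by (intro cover) (auto simp: Us)
    with True show ?thesis by (simp add: of_nat_diff)
  next
    case False
    then have "real k \<le> real (n * N)" by linarith
    then show ?thesis using sum_list_nonneg_g[OF Us] by linarith
  qed
  then show ?thesis using n by (simp add: cover_value_def field_simps)
qed

lemma upper_integral_le:
  assumes f: "f \<in> bounded_functions" and c: "covers f n k Us"
  shows "upper_integral f \<le> cover_value n k Us"
  unfolding upper_integral_def
proof (rule cInf_lower)
  obtain N where N: "\<And>x. x \<in> \<Omega> \<Longrightarrow> \<bar>f x\<bar> \<le> int N"
    using f by (auto simp: bounded_functions_def)
  have "- int N \<le> f x" if "x \<in> \<Omega>" for x using N[OF that] by linarith
  then show "bdd_below {cover_value n k Us | n k Us. covers f n k Us}"
    by (intro bdd_belowI[of _ "- real N"]) (auto intro: cover_value_ge)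
qed (use c in auto)

lemma covers_exists:
  assumes "f \<in> bounded_functions"
  obtains n k Us where "covers f n k Us"
proof -
  obtain N where N: "\<And>x. x \<in> \<Omega> \<Longrightarrow> \<bar>f x\<bar> \<le> int N"
    using assms by (auto simp: bounded_functions_def)
  have "covers f 1 0 (concat (replicate N [\<Omega>]))"
    unfolding covers_def multiplicity_in_concat_replicate
    using N by (force simp: multiplicity_in_def)
  then show thesis by (rule that)
qed

lemma le_upper_integralI:
  assumes "f \<in> bounded_functions" "\<And>n k Us. covers f n k Us \<Longrightarrow> c \<le> cover_value n k Us"
  shows "c \<le> upper_integral f"
  unfolding upper_integral_def
  by (rule covers_exists[OF assms(1)], intro cInf_greatest) (use assms(2) in auto)

text \<open>The two bounds are brought to the common denominator \<open>n1 * n2\<close> by repeating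
  each list as often as the other denominator says. The values then add exactly, which makes the
  upper integral subadditive.\<close>

lemma covers_add:
  assumes "covers f1 n1 k1 Us1" "covers f2 n2 k2 Us2"
  defines "Us \<equiv> concat (replicate n2 Us1) @ concat (replicate n1 Us2)"
  shows "covers (f1 + f2) (n1 * n2) (n2 * k1 + n1 * k2) Us"
    and "cover_value (n1 * n2) (n2 * k1 + n1 * k2) Us = cover_value n1 k1 Us1 + cover_value n2 k2 Us2"
proof -
  have n: "n1 \<ge> 1" "n2 \<ge> 1" using assms(1,2) by (auto simp: covers_def)
  have "int (n1 * n2) * (f1 + f2) x + int (n2 * k1 + n1 * k2) \<le> int (multiplicity_in Us x)"
    if "x \<in> \<Omega>" for x
  proof -
    have "int n2 * (int n1 * f1 x + int k1) \<le> int n2 * int (multiplicity_in Us1 x)"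
      "int n1 * (int n2 * f2 x + int k2) \<le> int n1 * int (multiplicity_in Us2 x)"
      using assms(1,2) that by (auto intro!: mult_left_mono simp: covers_def)
    then show ?thesis by (simp add: Us_def algebra_simps)
  qed
  moreover have "set Us \<subseteq> M"
    using assms(1,2) by (auto simp: Us_def covers_def split: if_splits)
  ultimately show "covers (f1 + f2) (n1 * n2) (n2 * k1 + n1 * k2) Us"
    using n by (auto simp: covers_def)
  show "cover_value (n1 * n2) (n2 * k1 + n1 * k2) Us = cover_value n1 k1 Us1 + cover_value n2 k2 Us2"
    using n by (simp add: cover_value_def Us_def sum_list_concat_replicate field_simps)
qed

sublocale bounded: additive_subgroup bounded_functions
proof
  show "0 \<in> bounded_functions" by (auto simp: bounded_functions_def)
  fix f h assume f: "f \<in> bounded_functions"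
  then show "- f \<in> bounded_functions" by (simp add: bounded_functions_def)
  assume "h \<in> bounded_functions"
  then obtain N1 N2 where N: "\<forall>x\<in>\<Omega>. \<bar>f x\<bar> \<le> int N1" "\<forall>x\<in>\<Omega>. \<bar>h x\<bar> \<le> int N2"
    using f by (auto simp: bounded_functions_def)
  have "\<bar>(f + h) x\<bar> \<le> int (N1 + N2)" if "x \<in> \<Omega>" for x
    using N that abs_triangle_ineq[of "f x" "h x"] by fastforce
  then show "f + h \<in> bounded_functions" unfolding bounded_functions_def by blast
qed

lemma sublinear_upper_integral: "bounded.sublinear upper_integral"
  unfolding bounded.sublinear_def
proof (intro conjI ballI allI)
  have "covers 0 1 0 []" by (simp add: covers_def)
  from upper_integral_le[OF bounded.zero_closed this] have "upper_integral 0 \<le> 0"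
    by (simp add: cover_value_def)
  moreover have "0 \<le> upper_integral 0"
    using cover_value_ge[of 0 _ _ _ 0] by (intro le_upper_integralI bounded.zero_closed) auto
  ultimately show "upper_integral 0 = 0" by linarith
next
  fix f h assume f: "f \<in> bounded_functions" and h: "h \<in> bounded_functions"
  have *: "upper_integral (f + h) \<le> cover_value n k Us + cover_value n' k' Us'"
    if "covers f n k Us" "covers h n' k' Us'" for n k Us n' k' Us'
    using upper_integral_le[OF bounded.add_closed[OF f h] covers_add(1)[OF that]]
      covers_add(2)[OF that] by simp
  have "upper_integral (f + h) - upper_integral f \<le> cover_value n' k' Us'"
    if c': "covers h n' k' Us'" for n' k' Us'
  proof -
    have "upper_integral (f + h) - cover_value n' k' Us' \<le> upper_integral f"
      using *[OF _ c'] by (intro le_upper_integralI f) (simp add: algebra_simps)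
    then show ?thesis by linarith
  qed
  then have "upper_integral (f + h) - upper_integral f \<le> upper_integral h"
    by (intro le_upper_integralI h)
  then show "upper_integral (f + h) \<le> upper_integral f + upper_integral h" by linarith
next
  fix f m assume f: "f \<in> bounded_functions"
  show "real m * upper_integral f \<le> upper_integral (of_nat m * f)"
  proof (rule le_upper_integralI)
    show mf: "of_nat m * f \<in> bounded_functions" by (intro bounded.of_nat_mult_closed f)
    fix n k Us assume c: "covers (of_nat m * f) n k Us"
    show "real m * upper_integral f \<le> cover_value n k Us"
    proof (cases "m = 0")
      case True
      then show ?thesis using cover_value_ge[OF c, of 0] by simp
    next
      case False
      \<comment> \<open>A bound for \<open>m\<close> times \<open>f\<close> with denominator
        \<open>n\<close> is a bound for \<open>f\<close> with denominator
        \<open>n * m\<close>.\<close>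
      have "covers f (n * m) k Us"
        using c False by (auto simp: covers_def of_nat_fun algebra_simps)
      then have "upper_integral f \<le> cover_value (n * m) k Us" by (rule upper_integral_le[OF f])
      then have "real m * upper_integral f \<le> real m * cover_value (n * m) k Us"
        by (intro mult_left_mono) auto
      also have "\<dots> = cover_value n k Us" using False by (simp add: cover_value_def)
      finally show ?thesis .
    qed
  qed
qed

section \<open>From the upper integral to dominated probability measures\<close>

lemma indicator_bounded: "indicator U \<in> bounded_functions"
  by (auto simp: bounded_functions_def indicator_def intro!: exI[of _ 1])

lemma upper_integral_nonpos:
  assumes "f \<in> bounded_functions" "\<And>x. x \<in> \<Omega> \<Longrightarrow> f x \<le> 0"
  shows "upper_integral f \<le> 0"
proof -
  have "covers f 1 0 []" using assms(2) by (simp add: covers_def)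
  from upper_integral_le[OF assms(1) this] show ?thesis by (simp add: cover_value_def)
qed

text \<open>The one-element list \<open>[U]\<close> gives the upper estimate. For the lower one, a
  covering of the indicator has multiplicity at least \<open>k\<close> off \<open>U\<close> and
  \<open>n + k\<close> on \<open>U\<close>, which is precisely the hypothesis of the covering
  condition.\<close>

lemma upper_integral_indicator:
  assumes U: "U \<in> M"
  shows "upper_integral (indicator U) = g U"
proof (rule antisym)
  have "covers (indicator U) 1 0 [U]"
    using U by (auto simp: covers_def multiplicity_in_def indicator_def)
  from upper_integral_le[OF indicator_bounded this] show "upper_integral (indicator U) \<le> g U"
    by (simp add: cover_value_def)
  show "g U \<le> upper_integral (indicator U)"
  proof (rule le_upper_integralI[OF indicator_bounded])
    fix n k Us assume c: "covers (indicator U) n k Us"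
    have *: "int n * indicator U x + int k \<le> int (multiplicity_in Us x)" if "x \<in> \<Omega>" for x
      using c that by (auto simp: covers_def)
    have "real k + real n * g U \<le> sum_list (map g Us)"
    proof (rule cover[OF U])
      show "set Us \<subseteq> M" using c by (auto simp: covers_def)
      show "k \<le> multiplicity_in Us x" if "x \<in> \<Omega>" for x
        using *[OF that] by (cases "x \<in> U") auto
      show "n + k \<le> multiplicity_in Us x" if "x \<in> U" for x
        using *[of x] sets_into_space[OF U] that by (auto simp: indicator_def)
    qed
    then show "g U \<le> cover_value n k Us"
      using c by (simp add: covers_def cover_value_def field_simps)
  qed
qed

text \<open>The additive functional dominated by the upper integral and touching it at the indicator
  of \<open>U\<close> is restricted to indicators. Positivity and total mass come from evaluating it
  at negated indicators.\<close>

lemma dominated_prob_measure_exists: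
  assumes U: "U \<in> M"
  obtains \<mu> where "fin_prob_measure \<Omega> M \<mu>" "\<And>V. V \<in> M \<Longrightarrow> \<mu> V \<le> g V" "\<mu> U = g U"
proof -
  obtain I where add: "\<And>f h. f \<in> bounded_functions \<Longrightarrow> h \<in> bounded_functions \<Longrightarrow> I (f + h) = I f + I h"
    and le: "\<And>f. f \<in> bounded_functions \<Longrightarrow> I f \<le> upper_integral f"
    and eq: "I (indicator U) = upper_integral (indicator U)"
    using bounded.hahn_banach[OF sublinear_upper_integral indicator_bounded] by blast
  have I0: "I 0 = 0" using add[OF bounded.zero_closed bounded.zero_closed] by simp
  have minus: "I (- f) = - I f" if "f \<in> bounded_functions" for f
    using add[OF that bounded.uminus_closed[OF that]] I0 by simp
  define \<mu> where "\<mu> V = I (indicator V)" for V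
  have le_g: "\<mu> V \<le> g V" if "V \<in> M" for V
    using le[OF indicator_bounded, of V] upper_integral_indicator[OF that] by (simp add: \<mu>_def)
  have nonneg: "0 \<le> \<mu> V" for V
  proof -
    have "I (- indicator V) \<le> upper_integral (- indicator V)"
      by (intro le bounded.uminus_closed indicator_bounded)
    also have "\<dots> \<le> 0"
      by (intro upper_integral_nonpos bounded.uminus_closed indicator_bounded) simp
    finally show ?thesis using minus[OF indicator_bounded] by (simp add: \<mu>_def)
  qed
  have "\<mu> \<Omega> = 1"
  proof -
    \<comment> \<open>The empty list with \<open>k = 1\<close> bounds the constant \<open>-1\<close>
      on \<open>\<Omega>\<close> at value \<open>-1\<close>; negation then gives total mass at least
      1.\<close>
    have "covers (- indicator \<Omega>) 1 1 []" by (simp add: covers_def)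
    from upper_integral_le[OF bounded.uminus_closed[OF indicator_bounded] this]
    have "upper_integral (- indicator \<Omega>) \<le> - 1" by (simp add: cover_value_def)
    then have "1 \<le> \<mu> \<Omega>"
      using le[OF bounded.uminus_closed[OF indicator_bounded], of \<Omega>] minus[OF indicator_bounded, of \<Omega>]
      by (simp add: \<mu>_def)
    then show ?thesis using le_g[OF top] range[OF top] by auto
  qed
  moreover have "\<mu> {} = 0"
  proof -
    have "indicator {} = (0 :: 'a \<Rightarrow> int)" by (auto simp: fun_eq_iff)
    then show ?thesis using I0 by (simp add: \<mu>_def)
  qed
  moreover have "\<mu> (V \<union> W) = \<mu> V + \<mu> W" if "V \<inter> W = {}" for V W
  proof -
    have "indicator (V \<union> W) = (indicator V + indicator W :: 'a \<Rightarrow> int)"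
      using that by (auto simp: fun_eq_iff indicator_def)
    then show ?thesis using add[OF indicator_bounded indicator_bounded] by (simp add: \<mu>_def)
  qed
  moreover have "\<mu> V \<in> {0..1}" if "V \<in> M" for V
    using nonneg[of V] le_g[OF that] range[OF that] by auto
  ultimately have "fin_prob_measure \<Omega> M \<mu>"
    by (auto simp: fin_prob_measure_def additive_def)
  moreover have "\<mu> U = g U" using eq upper_integral_indicator[OF U] by (simp add: \<mu>_def)
  ultimately show thesis using le_g by (intro that)
qed

text \<open>The witness is the set of all probability measures dominated by \<open>g\<close>; at
  each \<open>U\<close> the supremum is attained.\<close>

theorem upper_prob_measure: "upper_prob_measure \<Omega> M g"
proof -
  define P where "P = {\<mu>. fin_prob_measure \<Omega> M \<mu> \<and> (\<forall>V\<in>M. \<mu> V \<le> g V)}"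
  have attained: "\<exists>\<mu>\<in>P. \<mu> U = g U" if "U \<in> M" for U
    by (rule dominated_prob_measure_exists[OF that]) (auto simp: P_def)
  have "g U = (SUP \<mu>\<in>P. \<mu> U)" if U: "U \<in> M" for U
  proof (rule antisym)
    have "bdd_above ((\<lambda>\<mu>. \<mu> U) ` P)" using U by (intro bdd_aboveI2[of _ _ "g U"]) (auto simp: P_def)
    then show "g U \<le> (SUP \<mu>\<in>P. \<mu> U)" using attained[OF U] cSUP_upper by fastforce
    show "(SUP \<mu>\<in>P. \<mu> U) \<le> g U"
      using attained[OF U] U by (intro cSUP_least) (auto simp: P_def)
  qed
  moreover have "P \<noteq> {}" using attained[OF top] by auto
  moreover have "\<forall>\<mu>\<in>P. fin_prob_measure \<Omega> M \<mu>" by (simp add: P_def)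
  ultimately show ?thesis
    using algebra_axioms range unfolding upper_prob_measure_def by blast
qed

end


section \<open>Maximal sets\<close>

lemma Ing_refl: "S \<in> Ing S"
  by (cases S) auto

lemma Ing_trans: "S \<in> Ing T \<Longrightarrow> R \<in> Ing S \<Longrightarrow> R \<in> Ing T"
  by (induction T) auto

lemma Bot_Form: "S \<in> Ing T \<Longrightarrow> Bot S \<in> Form T S"
  and Imp_Form: "\<phi> \<in> Form T S \<Longrightarrow> \<psi> \<in> Form T S \<Longrightarrow> Imp \<phi> \<psi> \<in> Form T S"
  by (auto simp: Form_def intro: has_sort.intros)

lemma Neg_Form: "S \<in> Ing T \<Longrightarrow> \<phi> \<in> Form T S \<Longrightarrow> Neg S \<phi> \<in> Form T S"
  unfolding Neg_def by (intro Imp_Form Bot_Form)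

lemma Bot_MForm: "S \<in> Ing T \<Longrightarrow> Bot S \<in> MForm T S"
  and Imp_MForm: "\<phi> \<in> MForm T S \<Longrightarrow> \<psi> \<in> MForm T S \<Longrightarrow> Imp \<phi> \<psi> \<in> MForm T S"
  by (auto simp: MForm_def intro: Bot_Form Imp_Form)

lemma Neg_MForm: "S \<in> Ing T \<Longrightarrow> \<phi> \<in> MForm T S \<Longrightarrow> Neg S \<phi> \<in> MForm T S"
  unfolding Neg_def by (intro Imp_MForm Bot_MForm)

lemma MForm_Form: "\<phi> \<in> MForm T S \<Longrightarrow> \<phi> \<in> Form T S"
  by (simp add: MForm_def)

lemma Prob_Form:
  "\<lbrakk>Delta S \<in> Ing T; p \<in> {0..1}; q \<in> {0..1}; \<phi> \<in> MForm T S\<rbrakk> \<Longrightarrow> Prob p q \<phi> \<in> Form T (Delta S)"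
  by (auto simp: Form_def MForm_def intro: has_sort.intros)

lemma BigOr_Form: "S \<in> Ing T \<Longrightarrow> set \<phi>s \<subseteq> Form T S \<Longrightarrow> BigOr S \<phi>s \<in> Form T S"
  by (induction \<phi>s) (auto simp: BigOr_def Or_def intro: Bot_Form Imp_Form Neg_Form)

lemma BigAnd_Form: "S \<in> Ing T \<Longrightarrow> set \<phi>s \<subseteq> Form T S \<Longrightarrow> BigAnd S \<phi>s \<in> Form T S"
  by (induction \<phi>s) (auto simp: BigAnd_def And_def Top_def intro: Bot_Form Imp_Form Neg_Form)

lemma at_least_disjuncts_Form:
  assumes "S \<in> Ing T" "\<And>i. i \<in> {1..m} \<Longrightarrow> \<phi> i \<in> Form T S"
  shows "set (map (\<lambda>I. BigAnd S (map \<phi> I)) (filter (\<lambda>I. length I = r) (subseqs [1..<Suc m])))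
    \<subseteq> Form T S"
proof -
  have "\<phi> i \<in> Form T S" if "I \<in> set (subseqs [1..<Suc m])" "i \<in> set I" for I i
  proof -
    have "set I \<in> Pow (set [1..<Suc m])"
      unfolding subseqs_powset[symmetric] using that(1) by (rule imageI)
    then show ?thesis using that(2) by (intro assms) auto
  qed
  then show ?thesis
    by (auto intro!: BigAnd_Form assms(1) simp del: in_set_subseqs upt_Suc)
qed

lemma at_least_Form:
  "S \<in> Ing T \<Longrightarrow> (\<And>i. i \<in> {1..m} \<Longrightarrow> \<phi> i \<in> Form T S) \<Longrightarrow> at_least S r m \<phi> \<in> Form T S"
  unfolding at_least_def by (intro BigOr_Form at_least_disjuncts_Form)

text \<open>Disjuncts of \<open>at_least\<close> are indexed by exactly \<open>r\<close> indices,
  whereas coverings give at least \<open>r\<close> true ones; the surplus is cut off.\<close>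

lemma subseq_of_filter:
  assumes "r \<le> length (filter P xs)"
  obtains ys where "subseq ys xs" "length ys = r" "\<forall>y\<in>set ys. P y"
proof
  have "subseq (take r (filter P xs)) (filter P xs)"
    by (metis append_take_drop_id list_emb_append2 list_emb_prefix subseq_order.order_refl)
  then show "subseq (take r (filter P xs)) xs"
    using subseq_filter_left subseq_order.trans by blast
  show "\<forall>y\<in>set (take r (filter P xs)). P y" by (auto dest: in_set_takeD)
qed (use assms in simp)

section \<open>Derived rules and the logic of maximal sets\<close>

context deduction_system
begin

lemma modus_ponensI:
  assumes "S \<in> Ing T" "D S \<Gamma> (Imp \<phi> \<psi>)" "D S \<Gamma> \<phi>" "\<psi> \<in> Form T S"
  shows "D S \<Gamma> \<psi>"
proof (rule cut)
  show "\<Gamma> \<subseteq> Form T S" using well_sorted assms by blast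
  show "\<forall>\<theta>\<in>{\<phi>, Imp \<phi> \<psi>}. D S \<Gamma> \<theta>" using assms by blast
  show "D S {\<phi>, Imp \<phi> \<psi>} \<psi>" using well_sorted assms by (blast intro: modus_ponens)
qed fact

lemma weaken: "S \<in> Ing T \<Longrightarrow> \<Gamma> \<subseteq> Form T S \<Longrightarrow> D S {} \<phi> \<Longrightarrow> D S \<Gamma> \<phi>"
  using cut[of S \<Gamma> "{}" \<phi>] by blast

lemma tautology_provable:
  "S \<in> Ing T \<Longrightarrow> \<phi> \<in> Form T S \<Longrightarrow> tautology \<phi> \<Longrightarrow> D S {} \<phi>"
  by (rule assumption_rule) (auto simp: Ax_def intro: is_ax.intros)

context
  fixes S y assumes S: "S \<in> Ing T" and y: "maximal T D S y"
begin

lemma maximal_subset_Form: "y \<subseteq> Form T S"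
  using y by (simp add: maximal_def consistent_def)

lemma mem_Form: "\<phi> \<in> y \<Longrightarrow> \<phi> \<in> Form T S"
  using maximal_subset_Form by blast

lemma Neg_mem_iff: "\<phi> \<in> Form T S \<Longrightarrow> Neg S \<phi> \<in> y \<longleftrightarrow> \<phi> \<notin> y"
  using y by (auto simp: maximal_def)

text \<open>Otherwise negation completeness would put the negation into \<open>y\<close>, and
  \<open>y\<close> would derive falsum.\<close>

lemma maximal_derivable:
  assumes "D S y \<phi>"
  shows "\<phi> \<in> y"
proof (rule ccontr)
  have \<phi>: "\<phi> \<in> Form T S" using well_sorted[OF S assms] by simp
  assume "\<phi> \<notin> y"
  then have "D S y (Neg S \<phi>)"
    using \<phi> by (intro assumption_rule S maximal_subset_Form) (simp add: Neg_mem_iff)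
  then have "D S y (Bot S)"
    unfolding Neg_def using assms S by (auto intro: modus_ponensI Bot_Form)
  then show False using y by (simp add: maximal_def consistent_def)
qed

lemma provable_mem: "D S {} \<phi> \<Longrightarrow> \<phi> \<in> y"
  by (rule maximal_derivable[OF weaken[OF S maximal_subset_Form]])

lemma ax_mem: "is_ax T S \<phi> \<Longrightarrow> \<phi> \<in> y"
  by (intro provable_mem assumption_rule S) (auto simp: Ax_def)

lemma derivable_mem: "D S \<Gamma> \<phi> \<Longrightarrow> \<Gamma> \<subseteq> y \<Longrightarrow> \<phi> \<in> y"
  by (rule maximal_derivable, rule cut[of S y \<Gamma>])
    (auto simp: S intro: assumption_rule mem_Form)

lemma Bot_not_mem: "Bot S \<notin> y"
proof
  assume "Bot S \<in> y"
  then have "D S y (Bot S)" by (intro assumption_rule S maximal_subset_Form) auto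
  then show False using y by (simp add: maximal_def consistent_def)
qed

lemma modus_ponens_mem: "Imp \<phi> \<psi> \<in> y \<Longrightarrow> \<phi> \<in> y \<Longrightarrow> \<psi> \<in> Form T S \<Longrightarrow> \<psi> \<in> y"
  by (rule derivable_mem[OF modus_ponens[OF S]]) (auto intro: mem_Form)

lemma Imp_mem_iff:
  assumes \<phi>: "\<phi> \<in> Form T S" and \<psi>: "\<psi> \<in> Form T S"
  shows "Imp \<phi> \<psi> \<in> y \<longleftrightarrow> (\<phi> \<in> y \<longrightarrow> \<psi> \<in> y)"
proof
  assume R: "\<phi> \<in> y \<longrightarrow> \<psi> \<in> y"
  \<comment> \<open>One tautology for each way an implication can hold: a false premise here, a true
    conclusion next.\<close>
  have "Imp (Neg S \<phi>) (Imp \<phi> \<psi>) \<in> y"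
    by (intro ax_mem is_ax.intros(1) Imp_Form Neg_Form S \<phi> \<psi>) (simp add: tautology_def Neg_def)
  moreover have "Imp \<psi> (Imp \<phi> \<psi>) \<in> y"
    by (intro ax_mem is_ax.intros(1) Imp_Form S \<phi> \<psi>) (simp add: tautology_def)
  ultimately show "Imp \<phi> \<psi> \<in> y"
    using R Neg_mem_iff[OF \<phi>] modus_ponens_mem Imp_Form[OF \<phi> \<psi>] by blast
qed (use \<psi> modus_ponens_mem in blast)

lemma BigOr_mem_iff: "set \<phi>s \<subseteq> Form T S \<Longrightarrow> BigOr S \<phi>s \<in> y \<longleftrightarrow> (\<exists>\<phi>\<in>set \<phi>s. \<phi> \<in> y)"
proof (induction \<phi>s)
  case Nil
  then show ?case by (simp add: BigOr_def Bot_not_mem)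
next
  case (Cons \<phi> \<phi>s)
  have "BigOr S (\<phi> # \<phi>s) = Imp (Neg S \<phi>) (BigOr S \<phi>s)" by (simp add: BigOr_def Or_def)
  then show ?case using Cons by (auto simp: Imp_mem_iff Neg_mem_iff Neg_Form BigOr_Form S)
qed

lemma BigAnd_mem_iff: "set \<phi>s \<subseteq> Form T S \<Longrightarrow> BigAnd S \<phi>s \<in> y \<longleftrightarrow> (\<forall>\<phi>\<in>set \<phi>s. \<phi> \<in> y)"
proof (induction \<phi>s)
  case Nil
  then show ?case by (simp add: BigAnd_def Top_def Neg_mem_iff Bot_Form S Bot_not_mem)
next
  case (Cons \<phi> \<phi>s)
  have "BigAnd S (\<phi> # \<phi>s) = Neg S (Imp \<phi> (Neg S (BigAnd S \<phi>s)))"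
    by (simp add: BigAnd_def And_def)
  then show ?case using Cons
    by (auto simp: Imp_mem_iff Neg_mem_iff Neg_Form Imp_Form BigAnd_Form S)
qed

text \<open>Turns a count of true formulas into membership of the syntactic formula that the cover
  rules speak about.\<close>

lemma at_least_mem:
  assumes "\<And>i. i \<in> {1..m} \<Longrightarrow> \<phi> i \<in> Form T S"
    and "r \<le> length (filter (\<lambda>i. \<phi> i \<in> y) [1..<Suc m])"
  shows "at_least S r m \<phi> \<in> y"
proof -
  obtain I where I: "subseq I [1..<Suc m]" "length I = r" "\<forall>i\<in>set I. \<phi> i \<in> y"
    using subseq_of_filter[OF assms(2)] by blast
  then have "BigAnd S (map \<phi> I) \<in> y"
    by (subst BigAnd_mem_iff) (auto simp: mem_Form)
  then show ?thesis
    unfolding at_least_def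
    using I by (subst BigOr_mem_iff[OF at_least_disjuncts_Form]) (auto simp: S assms(1))
qed

end

text \<open>If \<open>\<phi>\<close> is not provable, its negation alone is consistent, by the
  deduction rule and double negation, and so lies in some maximal set, which then omits
  \<open>\<phi>\<close>.\<close>

lemma provable_if_all_maximal:
  assumes L: "lindenbaum T D" and S: "S \<in> Ing T" and \<phi>: "\<phi> \<in> Form T S"
    and all: "\<And>y. maximal T D S y \<Longrightarrow> \<phi> \<in> y"
  shows "D S {} \<phi>"
proof (rule ccontr)
  assume not: "\<not> D S {} \<phi>"
  have "\<not> D S {Neg S \<phi>} (Bot S)"
  proof
    assume "D S {Neg S \<phi>} (Bot S)"
    then have "D S {} (Imp (Neg S \<phi>) (Bot S))" by (intro deduction S) simp
    moreover have "D S {} (Imp (Imp (Neg S \<phi>) (Bot S)) \<phi>)"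
      by (intro tautology_provable Imp_Form Neg_Form Bot_Form S \<phi>) (simp add: tautology_def Neg_def)
    ultimately show False using not modus_ponensI[OF S _ _ \<phi>] by blast
  qed
  then have "consistent T D S {Neg S \<phi>}" using Neg_Form[OF S \<phi>] by (simp add: consistent_def)
  then obtain y where "maximal T D S y" "Neg S \<phi> \<in> y"
    using L S unfolding lindenbaum_def by blast
  then show False using all Neg_mem_iff[OF S _ \<phi>] by blast
qed

section \<open>The algebra of truth sets\<close>

lemma truth_set_Neg:
  "S \<in> Ing T \<Longrightarrow> \<phi> \<in> Form T S \<Longrightarrow> truth_set T D S (Neg S \<phi>) = canon_space T D S - truth_set T D S \<phi>"
  by (auto simp: truth_set_def canon_space_def Neg_mem_iff)

lemma truth_set_Imp:
  "S \<in> Ing T \<Longrightarrow> \<phi> \<in> Form T S \<Longrightarrow> \<psi> \<in> Form T S \<Longrightarrow>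
   truth_set T D S (Imp \<phi> \<psi>) = (canon_space T D S - truth_set T D S \<phi>) \<union> truth_set T D S \<psi>"
  by (auto simp: truth_set_def canon_space_def Imp_mem_iff)

lemma truth_set_Bot: "S \<in> Ing T \<Longrightarrow> truth_set T D S (Bot S) = {}"
  by (auto simp: truth_set_def canon_space_def Bot_not_mem)

lemma algebra_canon:
  assumes S: "S \<in> Ing T"
  shows "algebra (canon_space T D S) (canon_algebra T D S)"
  unfolding algebra_iff_Un
proof (intro conjI ballI)
  show "canon_algebra T D S \<subseteq> Pow (canon_space T D S)"
    by (auto simp: canon_algebra_def truth_set_def)
  show "{} \<in> canon_algebra T D S"
    unfolding canon_algebra_def using truth_set_Bot[OF S] Bot_MForm[OF S] by blast
next
  fix U assume "U \<in> canon_algebra T D S"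
  then obtain \<phi> where \<phi>: "\<phi> \<in> MForm T S" "U = truth_set T D S \<phi>" by (auto simp: canon_algebra_def)
  then have "canon_space T D S - U = truth_set T D S (Neg S \<phi>)"
    by (simp add: truth_set_Neg S MForm_Form)
  then show "canon_space T D S - U \<in> canon_algebra T D S"
    unfolding canon_algebra_def using Neg_MForm[OF S \<phi>(1)] by blast
  fix V assume "V \<in> canon_algebra T D S"
  then obtain \<psi> where \<psi>: "\<psi> \<in> MForm T S" "V = truth_set T D S \<psi>" by (auto simp: canon_algebra_def)
  have "U \<union> V = truth_set T D S (Imp (Neg S \<phi>) \<psi>)"
    unfolding \<phi>(2) \<psi>(2)
    by (subst truth_set_Imp truth_set_Neg; (intro S Neg_Form MForm_Form \<phi>(1) \<psi>(1))?)+
      (auto simp: truth_set_def)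
  then show "U \<union> V \<in> canon_algebra T D S"
    unfolding canon_algebra_def using Imp_MForm[OF Neg_MForm[OF S \<phi>(1)] \<psi>(1)] by blast
qed

end


section \<open>The upper probability read off a maximal set\<close>

locale canonical_state = deduction_system T D
  for T :: "'m fexpr" and D :: "'m fexpr \<Rightarrow> 'm form set \<Rightarrow> 'm form \<Rightarrow> bool" +
  fixes S :: "'m fexpr" and x :: "'m form set"
  assumes lindenbaum: "lindenbaum T D"
    and Delta_Ing: "Delta S \<in> Ing T"
    and maximal_x: "maximal T D (Delta S) x"
begin

lemma S_Ing: "S \<in> Ing T"
  by (rule Ing_trans[OF Delta_Ing]) (simp add: Ing_refl)

lemmas x_ax = ax_mem[OF Delta_Ing maximal_x]
lemmas x_mp = modus_ponens_mem[OF Delta_Ing maximal_x]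
lemmas x_derivable = derivable_mem[OF Delta_Ing maximal_x]

section \<open>Threshold formulas in \<open>x\<close> and their supremum\<close>

lemma U_ge_Form: "\<phi> \<in> MForm T S \<Longrightarrow> p \<in> {0..1} \<Longrightarrow> U_ge p \<phi> \<in> Form T (Delta S)"
  unfolding U_ge_def by (intro Prob_Form Delta_Ing) auto

lemma U_le_Form: "\<phi> \<in> MForm T S \<Longrightarrow> p \<in> {0..1} \<Longrightarrow> U_le S p \<phi> \<in> Form T (Delta S)"
  unfolding U_le_def by (intro Prob_Form Delta_Ing Neg_MForm S_Ing) auto

lemma U_lt_mem_iff: "\<phi> \<in> MForm T S \<Longrightarrow> p \<in> {0..1} \<Longrightarrow> U_lt S p \<phi> \<in> x \<longleftrightarrow> U_ge p \<phi> \<notin> x"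
  unfolding U_lt_def by (intro Neg_mem_iff[OF Delta_Ing maximal_x] U_ge_Form)

context
  fixes \<phi> assumes \<phi>: "\<phi> \<in> MForm T S"
begin

lemma U_le_imp_not_U_ge:
  assumes "p \<in> {0..1}" "q \<in> {0..1}" "p < q" "U_le S p \<phi> \<in> x"
  shows "U_ge q \<phi> \<notin> x"
proof -
  have "U_lt S q \<phi> \<in> Form T (Delta S)"
    unfolding U_lt_def by (intro Neg_Form Delta_Ing U_ge_Form \<phi> assms)
  \<comment> \<open>\<open>is_ax.intros(9)\<close> is the axiom from \<open>U_le\<close> at
    \<open>p\<close> to \<open>U_lt\<close> at a larger \<open>q\<close>;
    \<open>is_ax.intros(10)\<close>, used in the next lemma, goes from \<open>U_lt\<close> to
    \<open>U_le\<close> at the same \<open>p\<close>.\<close>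
  then have "U_lt S q \<phi> \<in> x"
    using x_mp[OF x_ax[OF is_ax.intros(9)]] assms \<phi> Delta_Ing by blast
  then show ?thesis using U_lt_mem_iff \<phi> assms by blast
qed

lemma not_U_ge_imp_U_le:
  assumes "p \<in> {0..1}" "U_ge p \<phi> \<notin> x"
  shows "U_le S p \<phi> \<in> x"
  using x_mp[OF x_ax[OF is_ax.intros(10)]] assms \<phi> Delta_Ing U_lt_mem_iff U_le_Form by blast

text \<open>If \<open>U_ge p \<phi>\<close> failed, \<open>U_le S p \<phi>\<close> would hold and
  exclude \<open>U_ge q \<phi>\<close> for every larger \<open>q\<close>.\<close>

lemma U_ge_antimono:
  assumes "U_ge q \<phi> \<in> x" "p \<le> q" "p \<in> {0..1}" "q \<in> {0..1}"
  shows "U_ge p \<phi> \<in> x"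
  using assms not_U_ge_imp_U_le U_le_imp_not_U_ge by (metis order_le_less)

lemma U_ge_limit:
  assumes "p \<in> {0..1}" "\<And>q. q \<in> {0..1} \<Longrightarrow> q < p \<Longrightarrow> U_ge q \<phi> \<in> x"
  shows "U_ge p \<phi> \<in> x"
  by (rule x_derivable[OF archimedean_U[OF Delta_Ing \<phi> assms(1)]]) (use assms(2) in auto)

text \<open>\<open>U_le S p \<phi>\<close> is by definition \<open>L_ge (1 - p)\<close> of the
  negation, so the Archimedean rule for \<open>L_ge\<close>, a limit from below at
  \<open>1 - p\<close>, becomes a limit from above at \<open>p\<close>.\<close>

lemma U_le_limit:
  assumes p: "p \<in> {0..1}" and le: "\<And>q. q \<in> {0..1} \<Longrightarrow> p < q \<Longrightarrow> U_le S q \<phi> \<in> x"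
  shows "U_le S p \<phi> \<in> x"
  unfolding U_le_def L_ge_def[symmetric]
proof (rule x_derivable[OF archimedean_L[OF Delta_Ing Neg_MForm[OF S_Ing \<phi>]]])
  show "1 - p \<in> {0..1}" using p by auto
  have "L_ge q (Neg S \<phi>) \<in> x" if "q \<in> {0..1}" "q < 1 - p" for q
    using le[of "1 - q"] that by (auto simp: U_le_def L_ge_def)
  then show "{L_ge q (Neg S \<phi>) | q. q \<in> {0..1} \<and> q < 1 - p} \<subseteq> x" by blast
qed

text \<open>The thresholds in \<open>x\<close> form an initial segment of the unit interval by
  antitonicity, closed by the Archimedean rule, so the supremum is attained.\<close>

lemma sup_U_ge_range: "sup_U_ge x \<phi> \<in> {0..1}"
  and U_ge_mem_iff: "p \<in> {0..1} \<Longrightarrow> U_ge p \<phi> \<in> x \<longleftrightarrow> p \<le> sup_U_ge x \<phi>"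
proof -
  let ?A = "{q \<in> {0..1}. U_ge q \<phi> \<in> x}"
  \<comment> \<open>At \<open>p = 0\<close> the Archimedean rule has no premises, so the set of
    thresholds is never empty.\<close>
  have zero: "0 \<in> ?A" using U_ge_limit[of 0] by auto
  have bdd: "bdd_above ?A" by (intro bdd_aboveI[of _ 1]) auto
  show "sup_U_ge x \<phi> \<in> {0..1}"
    unfolding sup_U_ge_def using cSup_upper[OF zero bdd] zero
    by (auto intro!: cSup_least)
  show "U_ge p \<phi> \<in> x \<longleftrightarrow> p \<le> sup_U_ge x \<phi>" if p: "p \<in> {0..1}"
  proof
    assume "U_ge p \<phi> \<in> x"
    then show "p \<le> sup_U_ge x \<phi>" unfolding sup_U_ge_def using p by (intro cSup_upper bdd) auto
  next
    assume le: "p \<le> sup_U_ge x \<phi>"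
    show "U_ge p \<phi> \<in> x"
    proof (rule U_ge_limit[OF p])
      fix q assume q: "q \<in> {0..1}" "q < p"
      then have "q < Sup ?A" using le by (simp add: sup_U_ge_def)
      then obtain r where "r \<in> ?A" "q < r" using less_cSup_iff[OF _ bdd] zero by blast
      then show "U_ge q \<phi> \<in> x" using U_ge_antimono[of r q] q by auto
    qed
  qed
qed

text \<open>If the supremum exceeded \<open>p\<close>, the attained \<open>U_ge\<close> at the
  supremum would contradict \<open>U_le S p \<phi>\<close>. Conversely every \<open>q > p\<close>
  fails as a threshold, so \<open>U_le\<close> holds at \<open>q\<close>, and in the limit at
  \<open>p\<close>.\<close>

lemma U_le_mem_iff:
  assumes p: "p \<in> {0..1}"
  shows "U_le S p \<phi> \<in> x \<longleftrightarrow> sup_U_ge x \<phi> \<le> p"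
proof
  assume U: "U_le S p \<phi> \<in> x"
  show "sup_U_ge x \<phi> \<le> p"
  proof (rule ccontr)
    assume "\<not> sup_U_ge x \<phi> \<le> p"
    then show False
      using U_le_imp_not_U_ge[OF p sup_U_ge_range _ U] U_ge_mem_iff[OF sup_U_ge_range] by simp
  qed
next
  assume le: "sup_U_ge x \<phi> \<le> p"
  show "U_le S p \<phi> \<in> x"
  proof (rule U_le_limit[OF p])
    fix q :: real assume "q \<in> {0..1}" "p < q"
    then show "U_le S q \<phi> \<in> x" using not_U_ge_imp_U_le U_ge_mem_iff le by auto
  qed
qed

end

text \<open>The implication is provable, so necessitation puts \<open>L_ge 1\<close> of it into
  \<open>x\<close>; the monotonicity axiom then carries the attained threshold
  \<open>sup_U_ge x \<phi>\<close> over to \<open>\<psi>\<close>.\<close>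

lemma sup_U_ge_mono:
  assumes \<phi>: "\<phi> \<in> MForm T S" and \<psi>: "\<psi> \<in> MForm T S"
    and sub: "truth_set T D S \<phi> \<subseteq> truth_set T D S \<psi>"
  shows "sup_U_ge x \<phi> \<le> sup_U_ge x \<psi>"
proof -
  let ?p = "sup_U_ge x \<phi>"
  note p = sup_U_ge_range[OF \<phi>]
  have Form: "\<phi> \<in> Form T S" "\<psi> \<in> Form T S" using \<phi> \<psi> by (simp_all add: MForm_Form)
  have "D S {} (Imp \<phi> \<psi>)"
    using sub Form
    by (intro provable_if_all_maximal lindenbaum S_Ing Imp_Form)
      (auto simp: Imp_mem_iff[OF S_Ing] truth_set_def canon_space_def)
  then have L: "L_ge 1 (Imp \<phi> \<psi>) \<in> x"
    by (intro provable_mem[OF Delta_Ing maximal_x] necessitation Delta_Ing Imp_MForm \<phi> \<psi>)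
  have "Imp (L_ge 1 (Imp \<phi> \<psi>)) (Imp (U_ge ?p \<phi>) (U_ge ?p \<psi>)) \<in> x"
    by (intro x_ax is_ax.intros(11) Delta_Ing \<phi> \<psi> p)
  then have "Imp (U_ge ?p \<phi>) (U_ge ?p \<psi>) \<in> x"
    by (rule x_mp[OF _ L]) (intro Imp_Form U_ge_Form \<phi> \<psi> p)
  moreover have "U_ge ?p \<phi> \<in> x" using U_ge_mem_iff[OF \<phi> p] by simp
  ultimately have "U_ge ?p \<psi> \<in> x" by (rule x_mp) (intro U_ge_Form \<psi> p)
  then show ?thesis using U_ge_mem_iff[OF \<psi> p] by simp
qed

lemma sup_U_ge_cong:
  "\<lbrakk>\<phi> \<in> MForm T S; \<psi> \<in> MForm T S; truth_set T D S \<phi> = truth_set T D S \<psi>\<rbrakk>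
    \<Longrightarrow> sup_U_ge x \<phi> = sup_U_ge x \<psi>"
  using sup_U_ge_mono by (metis order_refl antisym)

lemma canon_upper_truth_set:
  assumes "\<phi> \<in> MForm T S"
  shows "canon_upper T D S x (truth_set T D S \<phi>) = sup_U_ge x \<phi>"
  unfolding canon_upper_def
  using assms by (intro the_equality) (auto intro: sup_U_ge_cong)

lemma sup_U_ge_cover:
  fixes \<psi> :: "nat \<Rightarrow> 'm form"
  assumes \<phi>: "\<phi> \<in> MForm T S" and \<psi>: "\<And>i. i \<in> {1..m} \<Longrightarrow> \<psi> i \<in> MForm T S"
    and k: "\<And>y. maximal T D S y \<Longrightarrow> k \<le> length (filter (\<lambda>i. \<psi> i \<in> y) [1..<Suc m])"
    and nk: "\<And>y. maximal T D S y \<Longrightarrow> \<phi> \<in> y \<Longrightarrow>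
      n + k \<le> length (filter (\<lambda>i. \<psi> i \<in> y) [1..<Suc m])"
  shows "real k + real n * sup_U_ge x \<phi> \<le> (\<Sum>i=1..m. sup_U_ge x (\<psi> i))"
proof -
  let ?p = "\<lambda>i. sup_U_ge x (\<psi> i)"
  let ?conj = "BigAnd (Delta S) (map (\<lambda>i. U_le S (?p i) (\<psi> i)) [1..<Suc m])"
  have \<psi>_Form: "\<psi> i \<in> Form T S" if "i \<in> {1..m}" for i using \<psi>[OF that] by (rule MForm_Form)
  have p: "?p i \<in> {0..1}" if "i \<in> {1..m}" for i by (rule sup_U_ge_range[OF \<psi>[OF that]])
  have at_least_k: "D S {} (at_least S k m \<psi>)"
    by (intro provable_if_all_maximal lindenbaum S_Ing at_least_Form at_least_mem \<psi>_Form k)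
  have conj_Form: "set (map (\<lambda>i. U_le S (?p i) (\<psi> i)) [1..<Suc m]) \<subseteq> Form T (Delta S)"
    using U_le_Form \<psi> p by auto
  have "U_le S (?p i) (\<psi> i) \<in> x" if "i \<in> {1..m}" for i
    using U_le_mem_iff[OF \<psi>[OF that] p[OF that]] by simp
  then have conj: "?conj \<in> x"
    by (subst BigAnd_mem_iff[OF Delta_Ing maximal_x conj_Form]) auto
  \<comment> \<open>Otherwise the second cover rule would refute \<open>?conj\<close>, which lies in
    \<open>x\<close>. This is also the whole claim for \<open>n = 0\<close>.\<close>
  have k_le: "real k \<le> sum ?p {1..m}"
  proof (rule ccontr)
    assume "\<not> real k \<le> sum ?p {1..m}"
    then have "D (Delta S) {} (Neg (Delta S) ?conj)"
      using \<psi> p by (intro cover2[where k = k] Delta_Ing at_least_k) auto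
    then have "Neg (Delta S) ?conj \<in> x" by (rule provable_mem[OF Delta_Ing maximal_x])
    then show False
      using conj Neg_mem_iff[OF Delta_Ing maximal_x] BigAnd_Form[OF Delta_Ing conj_Form] by blast
  qed
  show ?thesis
  proof (cases "n = 0")
    case True
    then show ?thesis using k_le by simp
  next
    case False
    let ?b = "(sum ?p {1..m} - real k) / real n"
    have "D S {} (Imp \<phi> (at_least S (n + k) m \<psi>))"
    proof (rule provable_if_all_maximal[OF lindenbaum S_Ing])
      show "Imp \<phi> (at_least S (n + k) m \<psi>) \<in> Form T S"
        by (intro Imp_Form at_least_Form S_Ing \<psi>_Form MForm_Form[OF \<phi>])
      fix y assume y: "maximal T D S y"
      have "at_least S (n + k) m \<psi> \<in> y" if "\<phi> \<in> y"
        by (intro at_least_mem S_Ing y \<psi>_Form nk that)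
      then show "Imp \<phi> (at_least S (n + k) m \<psi>) \<in> y"
        by (subst Imp_mem_iff[OF S_Ing y]) (auto intro: at_least_Form S_Ing \<psi>_Form MForm_Form[OF \<phi>])
    qed
    then have "D (Delta S) {} (Imp ?conj (U_le S (max 0 (min 1 ?b)) \<phi>))"
      using \<psi> p False by (intro cover1 Delta_Ing at_least_k \<phi>) auto
    then have "Imp ?conj (U_le S (max 0 (min 1 ?b)) \<phi>) \<in> x"
      by (rule provable_mem[OF Delta_Ing maximal_x])
    then have "U_le S (max 0 (min 1 ?b)) \<phi> \<in> x"
      by (rule x_mp[OF _ conj]) (intro U_le_Form \<phi>, auto)
    then have "sup_U_ge x \<phi> \<le> max 0 (min 1 ?b)"
      by (subst (asm) U_le_mem_iff[OF \<phi>]) auto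
    \<comment> \<open>Nonnegativity of \<open>?b\<close> removes the truncation at 0; the truncation
      at 1 only lowers the bound.\<close>
    moreover have "0 \<le> ?b" using k_le by simp
    ultimately have "sup_U_ge x \<phi> \<le> ?b" by linarith
    then show ?thesis using False by (simp add: field_simps)
  qed
qed

text \<open>Choosing a representing formula for each set of the list turns a covering by truth sets
  into a family indexed from 1 to its length, to which \<open>sup_U_ge_cover\<close>
  applies.\<close>

lemma cover_function_canon_upper:
  "cover_function (canon_space T D S) (canon_algebra T D S) (canon_upper T D S x)"
proof (intro cover_function.intro algebra_canon S_Ing cover_function_axioms.intro)
  fix U assume "U \<in> canon_algebra T D S"
  then show "canon_upper T D S x U \<in> {0..1}"
    using sup_U_ge_range by (auto simp: canon_algebra_def canon_upper_truth_set simp del: atLeastAtMost_iff)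
next
  fix U Us k n
  assume U: "U \<in> canon_algebra T D S" and Us: "set Us \<subseteq> canon_algebra T D S"
    and k: "\<And>y. y \<in> canon_space T D S \<Longrightarrow> k \<le> multiplicity_in Us y"
    and nk: "\<And>y. y \<in> U \<Longrightarrow> n + k \<le> multiplicity_in Us y"
  obtain \<phi> where \<phi>: "\<phi> \<in> MForm T S" "U = truth_set T D S \<phi>"
    using U by (auto simp: canon_algebra_def)
  have "\<exists>\<psi>. \<psi> \<in> MForm T S \<and> V = truth_set T D S \<psi>" if "V \<in> set Us" for V
    using Us that by (auto simp: canon_algebra_def)
  then obtain rep where rep: "\<And>V. V \<in> set Us \<Longrightarrow> rep V \<in> MForm T S"
    "\<And>V. V \<in> set Us \<Longrightarrow> truth_set T D S (rep V) = V"
    by metis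
  let ?m = "length Us"
  \<comment> \<open>The shift by one reconciles list positions, which start at 0, with the indices
    of \<open>at_least\<close>, which start at 1.\<close>
  define \<psi> where "\<psi> i = rep (Us ! (i - 1))" for i
  have map_\<psi>: "map \<psi> [1..<Suc ?m] = map rep Us"
    by (rule nth_equalityI) (auto simp: \<psi>_def simp del: upt_Suc)
  have count: "length (filter (\<lambda>i. \<psi> i \<in> y) [1..<Suc ?m]) = multiplicity_in Us y"
    if "maximal T D S y" for y
  proof -
    have "length (filter (\<lambda>i. \<psi> i \<in> y) [1..<Suc ?m]) = length (filter (\<lambda>\<theta>. \<theta> \<in> y) (map \<psi> [1..<Suc ?m]))"
      by (simp add: filter_map comp_def del: upt_Suc)
    also have "\<dots> = length (filter (\<lambda>V. rep V \<in> y) Us)"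
      unfolding map_\<psi> by (simp add: filter_map comp_def)
    also have "filter (\<lambda>V. rep V \<in> y) Us = filter (\<lambda>V. y \<in> V) Us"
      using that rep(2) by (intro filter_cong) (auto simp: truth_set_def canon_space_def)
    finally show ?thesis by (simp add: multiplicity_in_def)
  qed
  have "real k + real n * sup_U_ge x \<phi> \<le> (\<Sum>i=1..?m. sup_U_ge x (\<psi> i))"
  proof (rule sup_U_ge_cover[OF \<phi>(1)])
    show "\<psi> i \<in> MForm T S" if "i \<in> {1..?m}" for i
      using that by (auto simp: \<psi>_def intro!: rep)
    show "k \<le> length (filter (\<lambda>i. \<psi> i \<in> y) [1..<Suc ?m])" if "maximal T D S y" for y
      unfolding count[OF that] using k that by (simp add: canon_space_def)
    show "n + k \<le> length (filter (\<lambda>i. \<psi> i \<in> y) [1..<Suc ?m])"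
      if "maximal T D S y" "\<phi> \<in> y" for y
      unfolding count[OF that(1)] using nk that by (simp add: \<phi>(2) truth_set_def canon_space_def)
  qed
  also have "(\<Sum>i=1..?m. sup_U_ge x (\<psi> i)) = sum_list (map (sup_U_ge x) (map \<psi> [1..<Suc ?m]))"
    by (simp add: comp_def interv_sum_list_conv_sum_set_nat atLeastLessThanSuc_atLeastAtMost del: upt_Suc)
  also have "\<dots> = sum_list (map (canon_upper T D S x) Us)"
    unfolding map_\<psi> using rep
    by (auto intro!: arg_cong[of _ _ sum_list] simp: canon_upper_truth_set[symmetric])
  finally show "real k + real n * canon_upper T D S x U \<le> sum_list (map (canon_upper T D S x) Us)"
    by (simp add: \<phi> canon_upper_truth_set)
qed

end

theorem theorem4p5:
  fixes T S :: "'m fexpr"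
    and D :: "'m fexpr \<Rightarrow> 'm form set \<Rightarrow> 'm form \<Rightarrow> bool"
    and x :: "'m form set"
  assumes "upper_prob_poly T"
    and "deduction_system T D"
    and "lindenbaum T D"
    and "Delta S \<in> Ing T"
    and "x \<in> canon_space T D (Delta S)"
  shows "(\<forall>\<phi>\<in>MForm T S. \<forall>\<psi>\<in>MForm T S.
            truth_set T D S \<phi> = truth_set T D S \<psi> \<longrightarrow> sup_U_ge x \<phi> = sup_U_ge x \<psi>)
       \<and> (\<forall>\<phi>\<in>MForm T S. canon_upper T D S x (truth_set T D S \<phi>) = sup_U_ge x \<phi>)
       \<and> upper_prob_measure (canon_space T D S) (canon_algebra T D S) (canon_upper T D S x)"
proof -
  interpret canonical_state T D S x
    using assms by (auto simp: canonical_state_def canonical_state_axioms_def canon_space_def)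
  show ?thesis
    using sup_U_ge_cong canon_upper_truth_set
      cover_function.upper_prob_measure[OF cover_function_canon_upper]
    by blast
qed

end
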